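(* Let $T\in\mathcal{E}'(\mathbb{R}^d)$ and suppose there are finitely many functions $t_\beta\in L_1(\mathbb{R}^d)$ with compact support such that $T=\sum_\beta\partial^\beta t_\beta$ and $x^{-\gamma}t_\beta(x)\in L_1(\mathbb{R}^d)$ for all $\gamma\in\mathbb{N}_0^d$ and all $\beta$. Then there is $L\in\mathcal{M}(\mathbb{R}^d)$ whose restriction to $C^\infty(\mathbb{R}^d)$ equals $M_T$.
   Context: For $T\in\mathcal{E}'(\mathbb{R}^d)$, $M_T:C^\infty(\mathbb{R}^d)\to C^\infty(\mathbb{R}^d)$ is $(M_Tf)(y)=T_x f(xy)$, where $xy$ is the coordinatewise product; $x^{-\gamma}=1/(x_1^{\gamma_1}\cdots x_d^{\gamma_d})$. $C^\infty(\mathbb{R}^d)$ is regarded as a subspace of $\mathcal{D}'(\mathbb{R}^d)$ via $f\mapsto(\varphi\mapsto\int f\varphi\,dx)$. $\mathcal{M}(\mathbb{R}^d)$ is the set of continuous linear operators on $\mathcal{D}'(\mathbb{R}^d)$ admitting every monomial $x^\alpha$, $\alpha\in\mathbb{N}_0^d$, as eigenvector. *)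

theory Defs
  imports "HOL-Analysis.Analysis"
begin

type_synonym 'n fn = "real^'n \<Rightarrow> complex"
type_synonym 'n functional = "'n fn \<Rightarrow> complex"

definition dpart :: "'n::finite \<Rightarrow> 'n fn \<Rightarrow> 'n fn" where
  "dpart i f x = vector_derivative (\<lambda>t. f (x + t *\<^sub>R axis i 1)) (at 0)"

fun iter_pd :: "'n::finite list \<Rightarrow> 'n fn \<Rightarrow> 'n fn" where
  "iter_pd [] f = f"
| "iter_pd (i # is) f = dpart i (iter_pd is f)"

definition mlist :: "('n::finite \<Rightarrow> nat) \<Rightarrow> 'n list" where
  "mlist \<beta> = (SOME xs. \<forall>i. count_list xs i = \<beta> i)"

definition pdm :: "('n::finite \<Rightarrow> nat) \<Rightarrow> 'n fn \<Rightarrow> 'n fn" where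
  "pdm \<beta> f = iter_pd (mlist \<beta>) f"

definition mabs :: "('n::finite \<Rightarrow> nat) \<Rightarrow> nat" where
  "mabs \<beta> = (\<Sum>i\<in>UNIV. \<beta> i)"

definition smooth :: "'n::finite fn \<Rightarrow> bool" where
  "smooth f \<longleftrightarrow> (\<forall>is. continuous_on UNIV (iter_pd is f) \<and>
      (\<forall>i x. (\<lambda>t. iter_pd is f (x + t *\<^sub>R axis i 1)) differentiable (at 0)))"

definition supp :: "'n::finite fn \<Rightarrow> (real^'n) set" where
  "supp f = closure {x. f x \<noteq> 0}"

definition test :: "'n::finite fn \<Rightarrow> bool" where
  "test \<phi> \<longleftrightarrow> smooth \<phi> \<and> compact (supp \<phi>)"

definition seminorm :: "(real^'n::finite) set \<Rightarrow> nat \<Rightarrow> 'n fn \<Rightarrow> real" where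
  "seminorm K N f = (\<Sum>\<alpha>\<in>{\<alpha>. mabs \<alpha> \<le> N}. (SUP x\<in>K. norm (pdm \<alpha> f x)))"

definition Eprime :: "'n::finite functional \<Rightarrow> bool" where
  "Eprime T \<longleftrightarrow>
     (\<forall>f g a b. smooth f \<longrightarrow> smooth g \<longrightarrow> T (\<lambda>x. a * f x + b * g x) = a * T f + b * T g) \<and>
     (\<exists>K C N. compact K \<and> (\<forall>f. smooth f \<longrightarrow> norm (T f) \<le> C * seminorm K N f))"

text \<open>D'(R^d): continuous linear functionals on test functions. Only values on test
  functions are meaningful; two distributions are equal iff they agree on test functions.\<close>
definition distr :: "'n::finite functional \<Rightarrow> bool" where
  "distr u \<longleftrightarrow>
     (\<forall>\<phi> \<psi> a b. test \<phi> \<longrightarrow> test \<psi> \<longrightarrow> u (\<lambda>x. a * \<phi> x + b * \<psi> x) = a * u \<phi> + b * u \<psi>) \<and>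
     (\<forall>K. compact K \<longrightarrow> (\<exists>C N. \<forall>\<phi>. test \<phi> \<longrightarrow> supp \<phi> \<subseteq> K \<longrightarrow>
          norm (u \<phi>) \<le> C * seminorm K N \<phi>))"

definition deq :: "'n::finite functional \<Rightarrow> 'n functional \<Rightarrow> bool" where
  "deq u v \<longleftrightarrow> (\<forall>\<phi>. test \<phi> \<longrightarrow> u \<phi> = v \<phi>)"

definition emb :: "'n::finite fn \<Rightarrow> 'n functional" where
  "emb f = (\<lambda>\<phi>. LINT x|lborel. f x * \<phi> x)"

text \<open>Continuous linear operators on D'(R^d) (continuity w.r.t. the weak-* topology;
  for the reflexive space D this is the same class as for the strong topology).\<close>
definition cont_lin_op :: "('n::finite functional \<Rightarrow> 'n functional) \<Rightarrow> bool" where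
  "cont_lin_op L \<longleftrightarrow>
     (\<forall>u. distr u \<longrightarrow> distr (L u)) \<and>
     (\<forall>u v. distr u \<longrightarrow> distr v \<longrightarrow> deq u v \<longrightarrow> deq (L u) (L v)) \<and>
     (\<forall>u v a b. distr u \<longrightarrow> distr v \<longrightarrow>
         deq (L (\<lambda>\<phi>. a * u \<phi> + b * v \<phi>)) (\<lambda>\<phi>. a * L u \<phi> + b * L v \<phi>)) \<and>
     (\<forall>\<phi> \<epsilon>. test \<phi> \<longrightarrow> \<epsilon> > 0 \<longrightarrow>
        (\<exists>\<Psi> \<delta>. finite \<Psi> \<and> (\<forall>\<psi>\<in>\<Psi>. test \<psi>) \<and> \<delta> > 0 \<and>
           (\<forall>u. distr u \<longrightarrow> (\<forall>\<psi>\<in>\<Psi>. norm (u \<psi>) < \<delta>) \<longrightarrow> norm (L u \<phi>) < \<epsilon>)))"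

definition monomial :: "('n::finite \<Rightarrow> nat) \<Rightarrow> 'n fn" where
  "monomial \<alpha> = (\<lambda>x. complex_of_real (\<Prod>i\<in>UNIV. (x $ i) ^ \<alpha> i))"

definition Mclass :: "('n::finite functional \<Rightarrow> 'n functional) \<Rightarrow> bool" where
  "Mclass L \<longleftrightarrow> cont_lin_op L \<and>
     (\<forall>\<alpha>. \<exists>c. deq (L (emb (monomial \<alpha>))) (\<lambda>\<phi>. c * emb (monomial \<alpha>) \<phi>))"

definition MT :: "'n::finite functional \<Rightarrow> 'n fn \<Rightarrow> 'n fn" where
  "MT T f = (\<lambda>y. T (\<lambda>x. f (x * y)))"

end

theory Submission
  imports Defs "HOL-Computational_Algebra.Polynomial"
begin

text \<open>
  Formally, \<open>\<integral> (M\<^sub>T f) \<phi> = \<Sum>\<^sub>\<beta> (-1)\<^bsup>|\<beta>|\<^esup> \<integral> t\<^sub>\<beta>(x) \<integral> y\<^sup>\<beta> \<phi>(y) (\<partial>\<^sup>\<beta> f)(xy) dy dx\<close>. Integrating by parts in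
  \<open>y\<close> and substituting \<open>z = xy\<close> turns this into \<open>\<integral> f S\<phi>\<close>, where
  \<open>S\<phi>(z) = \<Sum>\<^sub>\<beta> \<integral> t\<^sub>\<beta>(x) x\<^sup>-\<^sup>\<beta> |x\<^sub>1 \<cdots> x\<^sub>d|\<^sup>-\<^sup>1 h\<^sub>\<beta>(z/x) dx\<close> and \<open>h\<^sub>\<beta> = \<partial>\<^sup>\<beta> (y\<^sup>\<beta> \<phi>)\<close>. Differentiating \<open>S\<phi>\<close> only
  produces further negative powers of \<open>x\<close>, which \<open>t\<^sub>\<beta>\<close> absorbs by hypothesis; hence \<open>S\<close> maps test
  functions continuously to test functions, and \<open>L u = u \<circ> S\<close> is the required operator. A cutoff
  function equal to \<open>1\<close> near the supports of \<open>T\<close> and of all \<open>t\<^sub>\<beta>\<close> extends the representation of \<open>T\<close>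
  from test functions to smooth functions.
\<close>

subsection \<open>Partial derivatives and smooth functions\<close>

text \<open>The factor \<open>|x_1 ... x_d|^-1\<close> is the Jacobian of \<open>y = z/x\<close>.
  This substitution breaks down on the coordinate hyperplanes; they form a null set, so the kernel
  may be set to zero there and the inner integrals need only be compared for almost every
  \<open>x\<close>. Compact support of \<open>S\<phi>\<close> comes from \<open>z = x (z/x)\<close>,
  with \<open>x\<close> in the support of the kernel and \<open>z/x\<close> in that of
  \<open>h_\<beta>\<close>. The resulting radius depends on \<open>\<phi>\<close> only through a
  compact set containing its support, which is what continuity requires. The
  \<open>x^\<alpha>\<close> are eigenvectors of \<open>L\<close> because they are eigenvectors of
  \<open>M_T\<close>, with eigenvalue \<open>T(x^\<alpha>)\<close>. Smoothness is given here by
  continuity and axis-wise differentiability of all iterated derivatives, and \<open>pdm\<close>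
  uses one chosen order of differentiation, whereas integration by parts and the Leibniz rule yield
  other orders. Symmetry of mixed partials therefore has to be proved before the seminorms can bound
  them.\<close>

definition has_pd :: "'n::finite \<Rightarrow> 'n fn \<Rightarrow> 'n fn \<Rightarrow> bool" where
  "has_pd i f g \<longleftrightarrow>
     (\<forall>x. ((\<lambda>t. f (x + t *\<^sub>R axis i 1)) has_vector_derivative g x) (at 0))"

lemma dpart_eq: "has_pd i f g \<Longrightarrow> dpart i f = g"
  by (auto simp: has_pd_def dpart_def fun_eq_iff vector_derivative_at)

text \<open>Shifting the base point by \<open>s\<close> along the axis turns the derivative at 0
  into one at every parameter, the form needed for the fundamental theorem of calculus and for
  differentiation under the integral.\<close>

lemma has_pd_line:
  assumes "has_pd i f g"
  shows "((\<lambda>t. f (x + t *\<^sub>R axis i 1)) has_vector_derivative g (x + s *\<^sub>R axis i 1)) (at s)"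
proof -
  have "((\<lambda>t. f ((x + s *\<^sub>R axis i 1) + t *\<^sub>R axis i 1)) has_vector_derivative
          g (x + s *\<^sub>R axis i 1)) (at (s - s))"
    using assms by (simp add: has_pd_def)
  moreover have "((\<lambda>t. t - s) has_vector_derivative 1) (at s)"
    by (auto intro!: derivative_eq_intros)
  ultimately have "((\<lambda>t. f ((x + s *\<^sub>R axis i 1) + t *\<^sub>R axis i 1)) \<circ> (\<lambda>t. t - s) has_vector_derivative
          1 *\<^sub>R g (x + s *\<^sub>R axis i 1)) (at s)"
    by (intro vector_diff_chain_at) auto
  then show ?thesis
    by (simp add: o_def algebra_simps)
qed

lemma has_pd_const: "has_pd i (\<lambda>x. c) (\<lambda>x. 0)"
  by (simp add: has_pd_def)

lemma has_pd_coord: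
  "has_pd i (\<lambda>x. complex_of_real (x $ j)) (\<lambda>x. of_bool (i = j))"
  unfolding has_pd_def
  by (auto simp: axis_def intro!: derivative_eq_intros)

lemma has_pd_add:
  "has_pd i f f' \<Longrightarrow> has_pd i g g' \<Longrightarrow> has_pd i (\<lambda>x. f x + g x) (\<lambda>x. f' x + g' x)"
  unfolding has_pd_def by (auto intro: has_vector_derivative_add)

lemma has_pd_mult:
  assumes "has_pd i f f'" "has_pd i g g'"
  shows "has_pd i (\<lambda>x. f x * g x) (\<lambda>x. f x * g' x + f' x * g x)"
  unfolding has_pd_def
proof
  fix x :: "real^'a"
  have "((\<lambda>t. f (x + t *\<^sub>R axis i 1) * g (x + t *\<^sub>R axis i 1)) has_vector_derivative
      f (x + 0 *\<^sub>R axis i 1) * g' x + f' x * g (x + 0 *\<^sub>R axis i 1)) (at 0)"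
    using assms unfolding has_pd_def by (intro has_vector_derivative_mult) auto
  then show "((\<lambda>t. f (x + t *\<^sub>R axis i 1) * g (x + t *\<^sub>R axis i 1)) has_vector_derivative
      f x * g' x + f' x * g x) (at 0)" by simp
qed

lemma has_pd_inverse:
  assumes "has_pd i f f'" "\<And>x. f x \<noteq> 0"
  shows "has_pd i (\<lambda>x. inverse (f x)) (\<lambda>x. - f' x * (inverse (f x) * inverse (f x)))"
  unfolding has_pd_def
proof
  fix x :: "real^'a"
  let ?l = "\<lambda>t. f (x + t *\<^sub>R axis i 1)"
  have "(?l has_vector_derivative f' x) (at 0)"
    using assms(1) by (simp add: has_pd_def)
  moreover have "(inverse has_field_derivative - (inverse (f x) * 1 * inverse (f x))) (at (?l 0))"
    using assms(2)[of x] by (auto intro!: derivative_eq_intros)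
  ultimately have "(inverse \<circ> ?l has_vector_derivative
      f' x * - (inverse (f x) * 1 * inverse (f x))) (at 0)"
    by (rule field_vector_diff_chain_at)
  then show "((\<lambda>t. inverse (?l t)) has_vector_derivative
      - f' x * (inverse (f x) * inverse (f x))) (at 0)"
    by (simp add: o_def mult.commute)
qed

lemma axis_mult_scale:
  "(x + t *\<^sub>R axis i 1) * y = x * y + (t * y $ i) *\<^sub>R axis i (1::real)"
  by (auto simp: vec_eq_iff axis_def algebra_simps)

lemma has_pd_scale:
  assumes "has_pd i f f'"
  shows "has_pd i (\<lambda>x. f (x * y)) (\<lambda>x. of_real (y $ i) * f' (x * y))"
  unfolding has_pd_def
proof
  fix x :: "real^'a"
  have "((\<lambda>t. f (x * y + t *\<^sub>R axis i 1)) has_vector_derivative f' (x * y)) (at (0 * y $ i))"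
    using assms by (simp add: has_pd_def)
  moreover have "((\<lambda>t. t * y $ i) has_vector_derivative y $ i) (at 0)"
    by (auto intro!: derivative_eq_intros simp flip: has_real_derivative_iff_has_vector_derivative)
  ultimately have "((\<lambda>t. f (x * y + t *\<^sub>R axis i 1)) \<circ> (\<lambda>t. t * y $ i) has_vector_derivative
      y $ i *\<^sub>R f' (x * y)) (at 0)"
    by (intro vector_diff_chain_at) auto
  then show "((\<lambda>t. f ((x + t *\<^sub>R axis i 1) * y)) has_vector_derivative
      of_real (y $ i) * f' (x * y)) (at 0)"
    by (simp add: o_def axis_mult_scale scaleR_conv_of_real[where 'a=complex])
qed

lemma iter_pd_append: "iter_pd (xs @ ys) f = iter_pd xs (iter_pd ys f)"
  by (induction xs) auto

lemma smooth_iter_pd: "smooth f \<Longrightarrow> smooth (iter_pd is f)"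
  unfolding smooth_def by (metis iter_pd_append)

lemma smooth_dpart: "smooth f \<Longrightarrow> smooth (dpart i f)"
  using smooth_iter_pd[of f "[i]"] by simp

lemma smooth_continuous: "smooth f \<Longrightarrow> continuous_on UNIV f"
  unfolding smooth_def by (metis iter_pd.simps(1))

lemma smooth_has_pd: "smooth f \<Longrightarrow> has_pd i f (dpart i f)"
  unfolding smooth_def has_pd_def dpart_def
  by (metis iter_pd.simps(1) vector_derivative_works)

text \<open>Every \<open>iter_pd is f\<close> stays in \<open>C\<close>, so smoothness reduces to
  exhibiting a class of continuous functions closed under partial derivatives. The choice of this
  class is the main point of each use below.\<close>

lemma smooth_coinduct:
  assumes "f \<in> C"
    and "\<And>g. g \<in> C \<Longrightarrow> continuous_on UNIV g"
    and "\<And>g i. g \<in> C \<Longrightarrow> \<exists>g'\<in>C. has_pd i g g'"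
  shows "smooth f"
proof -
  have "iter_pd is f \<in> C" for "is"
  proof (induction "is")
    case (Cons i "is")
    then show ?case
      using assms(3)[OF Cons, of i] by (auto dest: dpart_eq)
  qed (use assms(1) in simp)
  then show ?thesis
    unfolding smooth_def
    using assms(2,3) unfolding has_pd_def by (meson differentiableI_vector)
qed

text \<open>The derivative of a product is a sum of products, and that of a reciprocal involves
  products of reciprocals. Closing under all these operations at once gives a class that is stable
  under differentiation.\<close>

inductive_set smooth_algebra :: "('n::finite fn) set" where
  base: "smooth f \<Longrightarrow> f \<in> smooth_algebra"
| add: "f \<in> smooth_algebra \<Longrightarrow> g \<in> smooth_algebra \<Longrightarrow> (\<lambda>x. f x + g x) \<in> smooth_algebra"
| mult: "f \<in> smooth_algebra \<Longrightarrow> g \<in> smooth_algebra \<Longrightarrow> (\<lambda>x. f x * g x) \<in> smooth_algebra"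
| inverse: "f \<in> smooth_algebra \<Longrightarrow> (\<And>x. f x \<noteq> 0) \<Longrightarrow> (\<lambda>x. inverse (f x)) \<in> smooth_algebra"

lemma smooth_const: "smooth (\<lambda>x. c)"
  by (rule smooth_coinduct[of _ "range (\<lambda>c x. c)"]) (auto intro: has_pd_const)

lemma smooth_coord: "smooth (\<lambda>x. complex_of_real (x $ j))"
proof (rule smooth_coinduct[of _ "insert (\<lambda>x. complex_of_real (x $ j)) (range (\<lambda>c x. c))"])
  fix g :: "'a fn" and i assume "g \<in> insert (\<lambda>x. complex_of_real (x $ j)) (range (\<lambda>c x. c))"
  then show "\<exists>g'\<in>insert (\<lambda>x. complex_of_real (x $ j)) (range (\<lambda>c x. c)). has_pd i g g'"
    using has_pd_const has_pd_coord[of i j] by auto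
qed (auto intro!: continuous_intros)

lemma smooth_algebra_continuous: "f \<in> smooth_algebra \<Longrightarrow> continuous_on UNIV f"
  by (induction rule: smooth_algebra.induct) (auto intro!: continuous_intros intro: smooth_continuous)

lemma smooth_algebra_has_pd: "f \<in> smooth_algebra \<Longrightarrow> \<exists>f'\<in>smooth_algebra. has_pd i f f'"
proof (induction rule: smooth_algebra.induct)
  case (base f)
  then show ?case
    using smooth_has_pd smooth_dpart smooth_algebra.base by blast
next
  case (add f g)
  then show ?case
    using has_pd_add smooth_algebra.add by blast
next
  case (mult f g)
  then show ?case
    using has_pd_mult smooth_algebra.add smooth_algebra.mult by blast
next
  case (inverse f)
  then obtain f' where f': "f' \<in> smooth_algebra" "has_pd i f f'"
    by blast
  have "(\<lambda>x. (-1 * f' x) * (inverse (f x) * inverse (f x))) \<in> smooth_algebra"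
    using inverse f' smooth_algebra.base[OF smooth_const[of "-1"]]
    by (intro smooth_algebra.mult smooth_algebra.inverse)
  then show ?case
    using has_pd_inverse[OF f'(2) inverse(2)] by auto
qed

lemma smooth_algebra_smooth: "f \<in> smooth_algebra \<Longrightarrow> smooth f"
  by (rule smooth_coinduct[of _ smooth_algebra])
     (auto intro: smooth_algebra_continuous smooth_algebra_has_pd)

lemma smooth_add: "smooth f \<Longrightarrow> smooth g \<Longrightarrow> smooth (\<lambda>x. f x + g x)"
  by (rule smooth_algebra_smooth[OF smooth_algebra.add[OF smooth_algebra.base smooth_algebra.base]])

lemma smooth_mult: "smooth f \<Longrightarrow> smooth g \<Longrightarrow> smooth (\<lambda>x. f x * g x)"
  by (rule smooth_algebra_smooth[OF smooth_algebra.mult[OF smooth_algebra.base smooth_algebra.base]])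

lemma smooth_inverse: "smooth f \<Longrightarrow> (\<And>x. f x \<noteq> 0) \<Longrightarrow> smooth (\<lambda>x. inverse (f x))"
  by (rule smooth_algebra_smooth[OF smooth_algebra.inverse[OF smooth_algebra.base]])

lemma smooth_cmult: "smooth f \<Longrightarrow> smooth (\<lambda>x. c * f x)"
  by (intro smooth_mult smooth_const)

lemma smooth_sum: "(\<And>i. i \<in> A \<Longrightarrow> smooth (f i)) \<Longrightarrow> smooth (\<lambda>x. \<Sum>i\<in>A. f i x)"
  by (induction A rule: infinite_finite_induct) (auto intro: smooth_const smooth_add)

lemma smooth_prod: "(\<And>i. i \<in> A \<Longrightarrow> smooth (f i)) \<Longrightarrow> smooth (\<lambda>x. \<Prod>i\<in>A. f i x)"
  by (induction A rule: infinite_finite_induct) (auto intro: smooth_const smooth_mult)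

lemma smooth_monomial: "smooth (monomial \<alpha>)"
proof -
  have "smooth (\<lambda>x. complex_of_real (x $ i) ^ n)" for i :: 'a and n
    by (induction n) (auto intro: smooth_const smooth_mult smooth_coord)
  then show ?thesis
    unfolding monomial_def of_real_prod of_real_power by (intro smooth_prod)
qed

lemma continuous_on_vec_times [continuous_intros]:
  fixes f g :: "'a::topological_space \<Rightarrow> real^'n"
  assumes "continuous_on S f" "continuous_on S g"
  shows "continuous_on S (\<lambda>x. f x * g x)"
  unfolding times_vec_def using assms by (intro continuous_intros) auto

text \<open>Each derivative in direction \<open>i\<close> brings out the constant
  \<open>y $ i\<close>; hence the class consists of all constant multiples
  \<open>c * g (x * y)\<close>.\<close>

lemma smooth_scale:
  assumes "smooth f"
  shows "smooth (\<lambda>x. f (x * y))"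
proof (rule smooth_coinduct[of _ "{\<lambda>x. c * g (x * y) |c g. smooth g}"])
  show "(\<lambda>x. f (x * y)) \<in> {\<lambda>x. c * g (x * y) |c g. smooth g}"
    using assms by (auto intro!: exI[of _ 1] exI[of _ f])
next
  fix h i assume "h \<in> {\<lambda>x. c * g (x * y) |c g. smooth g}"
  then obtain c g where h: "h = (\<lambda>x. c * g (x * y))" and g: "smooth g"
    by blast
  show "continuous_on UNIV h"
    unfolding h
    by (intro continuous_intros continuous_on_compose2[OF smooth_continuous[OF g]]) auto
  have "has_pd i h (\<lambda>x. (c * of_real (y $ i)) * dpart i g (x * y))"
    using has_pd_mult[OF has_pd_const[of i c] has_pd_scale[OF smooth_has_pd[OF g, of i], of y]]
    by (simp add: h mult.assoc)
  then show "\<exists>h'\<in>{\<lambda>x. c * g (x * y) |c g. smooth g}. has_pd i h h'"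
    using smooth_dpart[OF g] by blast
qed

section \<open>Algebra of iterated partial derivatives\<close>

lemma dpart_add: "smooth f \<Longrightarrow> smooth g \<Longrightarrow> dpart i (\<lambda>x. f x + g x) = (\<lambda>x. dpart i f x + dpart i g x)"
  by (intro dpart_eq has_pd_add smooth_has_pd)

lemma dpart_mult: "smooth f \<Longrightarrow> smooth g \<Longrightarrow>
    dpart i (\<lambda>x. f x * g x) = (\<lambda>x. f x * dpart i g x + dpart i f x * g x)"
  by (intro dpart_eq has_pd_mult smooth_has_pd)

lemma dpart_cmult: "smooth f \<Longrightarrow> dpart i (\<lambda>x. c * f x) = (\<lambda>x. c * dpart i f x)"
  using has_pd_mult[OF has_pd_const smooth_has_pd, of f i c] by (simp add: dpart_eq)

lemma iter_pd_add: "smooth f \<Longrightarrow> smooth g \<Longrightarrow>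
    iter_pd is (\<lambda>x. f x + g x) = (\<lambda>x. iter_pd is f x + iter_pd is g x)"
  by (induction "is") (auto simp: dpart_add smooth_iter_pd)

lemma iter_pd_cmult: "smooth f \<Longrightarrow> iter_pd is (\<lambda>x. c * f x) = (\<lambda>x. c * iter_pd is f x)"
  by (induction "is") (auto simp: dpart_cmult smooth_iter_pd)

lemma iter_pd_zero: "iter_pd is (\<lambda>x. 0) = (\<lambda>x. 0)"
  by (induction "is") (auto simp: dpart_eq[OF has_pd_const])

lemma iter_pd_sum: "(\<And>j. j \<in> A \<Longrightarrow> smooth (f j)) \<Longrightarrow>
    iter_pd is (\<lambda>x. \<Sum>j\<in>A. f j x) = (\<lambda>x. \<Sum>j\<in>A. iter_pd is (f j) x)"
  by (induction A rule: infinite_finite_induct)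
     (auto simp: iter_pd_add smooth_sum iter_pd_zero)

lemma iter_pd_scale:
  assumes "smooth f"
  shows "iter_pd is (\<lambda>x. f (x * y)) =
    (\<lambda>x. of_real (prod_list (map (\<lambda>i. y $ i) is)) * iter_pd is f (x * y))"
proof (induction "is")
  case (Cons i "is")
  have "smooth (iter_pd is f)"
    by (simp add: smooth_iter_pd assms)
  then show ?case
    using has_pd_scale[OF smooth_has_pd[of "iter_pd is f" i], of y]
    by (simp add: Cons dpart_cmult smooth_scale dpart_eq mult.assoc mult.left_commute)
qed simp

text \<open>A derivative at 0 sees only small \<open>t\<close>, for which
  \<open>x + t *\<^sub>R axis i 1\<close> stays in the open set \<open>U\<close>. This locality
  makes derivatives vanish outside supports and lets a cutoff be dropped where it equals 1.\<close>

lemma iter_pd_cong_open: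
  assumes "open U" "\<And>x. x \<in> U \<Longrightarrow> f x = g x" "x \<in> U"
  shows "iter_pd is f x = iter_pd is g x"
  using assms(3)
proof (induction "is" arbitrary: x)
  case (Cons i "is")
  have "open ((\<lambda>t. x + t *\<^sub>R axis i 1) -` U)"
    by (intro continuous_open_vimage assms(1) allI continuous_intros)
  then have "eventually (\<lambda>t. t \<in> (\<lambda>t. x + t *\<^sub>R axis i 1) -` U) (nhds (0::real))"
    using Cons.prems by (intro eventually_nhds_in_open) auto
  then have "eventually (\<lambda>t. iter_pd is f (x + t *\<^sub>R axis i 1) = iter_pd is g (x + t *\<^sub>R axis i 1)) (nhds (0::real))"
    by eventually_elim (simp add: Cons.IH)
  then show ?case
    by (simp add: dpart_def, intro vector_derivative_cong_eq) auto
qed (use assms in auto)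

subsection \<open>Commuting partial derivatives\<close>

text \<open>Along direction \<open>j\<close>, \<open>f\<close> is the integral of
  \<open>\<partial>_j f\<close>. Differentiating under this integral in direction \<open>i\<close>
  shows that the increment of \<open>\<partial>_i f\<close> is the integral of
  \<open>\<partial>_i \<partial>_j f\<close>; differentiating that in direction \<open>j\<close>
  gives the claim.\<close>

lemma dpart_commute:
  assumes f: "smooth f"
  shows "dpart i (dpart j f) = dpart j (dpart i f)"
proof
  fix x :: "real^'a"
  define ei ej :: "real^'a" where "ei = axis i 1" and "ej = axis j 1"
  let ?D = "dpart i (dpart j f)"
  have line: "((\<lambda>t. g (y + t *\<^sub>R axis k 1)) has_vector_derivative dpart k g (y + s *\<^sub>R axis k 1)) (at s)"
    if "smooth g" for g :: "'a fn" and y k s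
    using has_pd_line[OF smooth_has_pd[OF that]] .
  have smj: "smooth (dpart j f)" and smD: "smooth ?D"
    using f by (simp_all add: smooth_dpart)
  have A: "dpart i f (x + t *\<^sub>R ej) = dpart i f x + integral {0..t} (\<lambda>\<tau>. ?D (x + \<tau> *\<^sub>R ej))"
    if "0 \<le> t" for t
  proof -
    have ftc: "f (x + t *\<^sub>R ej + s *\<^sub>R ei) = f (x + s *\<^sub>R ei)
        + integral (cbox 0 t) (\<lambda>\<tau>. dpart j f (x + \<tau> *\<^sub>R ej + s *\<^sub>R ei))" for s
    proof -
      have "((\<lambda>\<tau>. dpart j f (x + s *\<^sub>R ei + \<tau> *\<^sub>R ej)) has_integral
          f (x + s *\<^sub>R ei + t *\<^sub>R ej) - f (x + s *\<^sub>R ei + 0 *\<^sub>R ej)) {0..t}"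
        by (rule fundamental_theorem_of_calculus[OF that])
           (rule has_vector_derivative_at_within, unfold ej_def, rule line[OF f])
      from integral_unique[OF this] show ?thesis
        by (simp add: algebra_simps)
    qed
    have "((\<lambda>s. integral (cbox 0 t) (\<lambda>\<tau>. dpart j f (x + \<tau> *\<^sub>R ej + s *\<^sub>R ei))) has_vector_derivative
        integral (cbox 0 t) (\<lambda>\<tau>. ?D (x + \<tau> *\<^sub>R ej + 0 *\<^sub>R ei))) (at 0 within UNIV)"
    proof (rule leibniz_rule_vector_derivative)
      show "((\<lambda>s. dpart j f (x + \<tau> *\<^sub>R ej + s *\<^sub>R ei)) has_vector_derivative
          ?D (x + \<tau> *\<^sub>R ej + s *\<^sub>R ei)) (at s within UNIV)" for s \<tau>
        using line[OF smj, of "x + \<tau> *\<^sub>R ej" i s] by (simp add: ei_def)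
      show "(\<lambda>\<tau>. dpart j f (x + \<tau> *\<^sub>R ej + s *\<^sub>R ei)) integrable_on cbox 0 t" for s
        by (intro integrable_continuous continuous_intros
            continuous_on_compose2[OF smooth_continuous[OF smj]]) auto
      show "continuous_on (UNIV \<times> cbox 0 t) (\<lambda>(s, \<tau>). ?D (x + \<tau> *\<^sub>R ej + s *\<^sub>R ei))"
        unfolding split_beta
        by (intro continuous_intros continuous_on_compose2[OF smooth_continuous[OF smD]]) auto
    qed auto
    moreover have "((\<lambda>s. f (x + s *\<^sub>R ei)) has_vector_derivative dpart i f x) (at 0)"
      using line[OF f, of x i 0] by (simp add: ei_def)
    ultimately have "((\<lambda>s. f (x + s *\<^sub>R ei) +
          integral (cbox 0 t) (\<lambda>\<tau>. dpart j f (x + \<tau> *\<^sub>R ej + s *\<^sub>R ei))) has_vector_derivative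
        dpart i f x + integral (cbox 0 t) (\<lambda>\<tau>. ?D (x + \<tau> *\<^sub>R ej + 0 *\<^sub>R ei))) (at 0)"
      by (intro has_vector_derivative_add)
    then have "((\<lambda>s. f (x + t *\<^sub>R ej + s *\<^sub>R ei)) has_vector_derivative
        dpart i f x + integral {0..t} (\<lambda>\<tau>. ?D (x + \<tau> *\<^sub>R ej))) (at 0)"
      unfolding ftc by simp
    moreover have "((\<lambda>s. f (x + t *\<^sub>R ej + s *\<^sub>R ei)) has_vector_derivative
        dpart i f (x + t *\<^sub>R ej)) (at 0)"
      using line[OF f, of "x + t *\<^sub>R ej" i 0] by (simp add: ei_def)
    ultimately show ?thesis
      using vector_derivative_unique_at by blast
  qed
  \<comment> \<open>Formula \<open>A\<close> is available for \<open>t \<ge> 0\<close>, so the two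
    derivatives are compared as one-sided derivatives at the left end of \<open>{0..1}\<close>,
    where they are still unique.\<close>
  have "((\<lambda>t. integral {0..t} (\<lambda>\<tau>. ?D (x + \<tau> *\<^sub>R ej))) has_vector_derivative
      ?D (x + 0 *\<^sub>R ej)) (at 0 within {0..1})"
    by (intro integral_has_vector_derivative continuous_intros
        continuous_on_compose2[OF smooth_continuous[OF smD]]) auto
  then have "((\<lambda>t. dpart i f x + integral {0..t} (\<lambda>\<tau>. ?D (x + \<tau> *\<^sub>R ej))) has_vector_derivative
      0 + ?D (x + 0 *\<^sub>R ej)) (at 0 within {0..1})"
    by (intro has_vector_derivative_add) auto
  from has_vector_derivative_transform[OF _ _ this, of "\<lambda>t. dpart i f (x + t *\<^sub>R ej)"]
  have "((\<lambda>t. dpart i f (x + t *\<^sub>R ej)) has_vector_derivative ?D x) (at 0 within {0..1})"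
    by (simp add: A)
  moreover have "((\<lambda>t. dpart i f (x + t *\<^sub>R ej)) has_vector_derivative dpart j (dpart i f) x)
      (at 0 within {0..1})"
    using has_vector_derivative_at_within[OF line[OF smooth_dpart[OF f, of i], of x j 0], of "{0..1}"]
    by (simp add: ej_def)
  ultimately show "?D x = dpart j (dpart i f) x"
    using vector_derivative_unique_within_closed_interval[of 0 1 0 "\<lambda>t. dpart i f (x + t *\<^sub>R ej)"]
    by (simp add: box_real)
qed

lemma iter_pd_dpart: "smooth f \<Longrightarrow> iter_pd xs (dpart i f) = dpart i (iter_pd xs f)"
proof (induction xs)
  case (Cons x xs)
  then show ?case
    using dpart_commute[OF smooth_iter_pd, of f x i xs] by simp
qed simp

text \<open>The head of one list occurs in the other and can be moved to its front, since
  \<open>dpart\<close> commutes with \<open>iter_pd\<close>.\<close>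

lemma iter_pd_mset_cong:
  assumes "smooth f" "mset xs = mset ys"
  shows "iter_pd xs f = iter_pd ys f"
  using assms(2)
proof (induction xs arbitrary: ys)
  case (Cons x xs)
  then have "x \<in> set ys"
    by (metis list.set_intros(1) set_mset_mset)
  then obtain us vs where ys: "ys = us @ x # vs"
    by (meson split_list)
  then have "iter_pd xs f = iter_pd (us @ vs) f"
    using Cons by auto
  then show ?case
    using assms(1) by (simp add: ys iter_pd_append iter_pd_dpart smooth_iter_pd)
qed simp

lemma count_list_mlist [simp]: "count_list (mlist \<beta>) i = \<beta> i"
proof -
  obtain xs where xs: "mset xs = (\<Sum>j\<in>UNIV. replicate_mset (\<beta> j) j)"
    using ex_mset by blast
  have "count_list xs i = \<beta> i" for i
    unfolding count_mset[symmetric] xs by (simp add: count_sum if_distrib)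
  then have "\<exists>xs. \<forall>i. count_list xs i = \<beta> i"
    by blast
  then have "\<forall>i. count_list (mlist \<beta>) i = \<beta> i"
    unfolding mlist_def by (rule someI_ex)
  then show ?thesis ..
qed

lemma length_mlist: "length (mlist \<beta>) = mabs \<beta>"
  unfolding mabs_def using sum_count_set[of "mlist \<beta>" UNIV] by simp

text \<open>Symmetry of mixed partials in the form used later: it brings derivatives along arbitrary
  lists under \<open>seminorm\<close>, which sees only \<open>pdm\<close>.\<close>

lemma iter_pd_eq_pdm: "smooth f \<Longrightarrow> iter_pd is f = pdm (count_list is) f"
  unfolding pdm_def by (rule iter_pd_mset_cong) (auto simp: multiset_eq_iff count_mset)

subsection \<open>Seminorms and test functions\<close>

lemma finite_mabs_le: "finite {\<alpha>::'n::finite \<Rightarrow> nat. mabs \<alpha> \<le> N}"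
proof (rule finite_subset)
  show "{\<alpha>::'n \<Rightarrow> nat. mabs \<alpha> \<le> N} \<subseteq> UNIV \<rightarrow>\<^sub>E {..N}"
  proof
    fix \<alpha> :: "'n \<Rightarrow> nat" assume "\<alpha> \<in> {\<alpha>. mabs \<alpha> \<le> N}"
    then have "\<alpha> i \<le> N" for i
      using member_le_sum[of i UNIV \<alpha>] by (simp add: mabs_def)
    then show "\<alpha> \<in> UNIV \<rightarrow>\<^sub>E {..N}"
      by auto
  qed
qed (auto intro: finite_PiE)

lemma bdd_above_pdm:
  "smooth f \<Longrightarrow> compact K \<Longrightarrow> bdd_above ((\<lambda>x. norm (pdm \<alpha> f x)) ` K)"
  unfolding pdm_def
  by (intro bounded_imp_bdd_above compact_imp_bounded compact_continuous_image continuous_intros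
      continuous_on_subset[OF smooth_continuous[OF smooth_iter_pd]]) auto

text \<open>Over the empty set the real supremum is an unspecified value of unknown sign; hence
  \<open>K \<noteq> {}\<close> here and in the estimates below.\<close>

lemma Sup_pdm_nonneg:
  assumes "smooth f" "compact K" "K \<noteq> {}"
  shows "0 \<le> (SUP x\<in>K. norm (pdm \<alpha> f x))"
proof -
  obtain x where "x \<in> K"
    using assms by blast
  then show ?thesis
    by (intro cSUP_upper2[OF bdd_above_pdm]) (use assms in auto)
qed

lemma seminorm_nonneg: "smooth f \<Longrightarrow> compact K \<Longrightarrow> K \<noteq> {} \<Longrightarrow> 0 \<le> seminorm K N f"
  unfolding seminorm_def by (intro sum_nonneg Sup_pdm_nonneg)

lemma seminorm_mono:
  "smooth f \<Longrightarrow> compact K \<Longrightarrow> K \<noteq> {} \<Longrightarrow> M \<le> N \<Longrightarrow> seminorm K M f \<le> seminorm K N f"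
  unfolding seminorm_def by (intro sum_mono2 finite_mabs_le Sup_pdm_nonneg) auto

lemma norm_iter_pd_le_seminorm:
  assumes "smooth f" "compact K" "x \<in> K"
  shows "norm (iter_pd is f x) \<le> seminorm K (length is) f"
proof -
  let ?\<alpha> = "count_list is"
  have "norm (iter_pd is f x) \<le> (SUP x\<in>K. norm (pdm ?\<alpha> f x))"
    unfolding iter_pd_eq_pdm[OF assms(1)] using assms by (intro cSUP_upper bdd_above_pdm)
  also have "mabs ?\<alpha> = length is"
    unfolding mabs_def using sum_count_set[of "is" UNIV] by simp
  then have "(SUP x\<in>K. norm (pdm ?\<alpha> f x)) \<le> seminorm K (length is) f"
    unfolding seminorm_def using assms
    by (intro member_le_sum finite_mabs_le Sup_pdm_nonneg) auto
  finally show ?thesis .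
qed

section \<open>Supports and test functions\<close>

lemma supp_subset_iff: "closed K \<Longrightarrow> supp f \<subseteq> K \<longleftrightarrow> (\<forall>x. x \<notin> K \<longrightarrow> f x = 0)"
  unfolding supp_def using closure_minimal[of "{x. f x \<noteq> 0}" K] closure_subset[of "{x. f x \<noteq> 0}"]
  by blast

lemma closed_supp: "closed (supp f)"
  by (simp add: supp_def)

lemma zero_outside_supp: "x \<notin> supp f \<Longrightarrow> f x = 0"
  using supp_subset_iff[OF closed_supp, of f f] by blast

lemma testI:
  assumes "smooth f" "compact K" "\<And>x. x \<notin> K \<Longrightarrow> f x = 0"
  shows "test f"
proof -
  have "supp f \<subseteq> K"
    using assms supp_subset_iff[of K f] by (auto simp: compact_imp_closed)
  then show ?thesis
    unfolding test_def using assms closed_supp[of f]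
    by (metis compact_Int_closed inf.absorb_iff2)
qed

lemma iter_pd_zero_outside:
  assumes "closed K" "\<And>x. x \<notin> K \<Longrightarrow> f x = 0" "x \<notin> K"
  shows "iter_pd is f x = 0"
  using iter_pd_cong_open[of "-K" f "\<lambda>x. 0" x "is"] assms by (auto simp: iter_pd_zero open_Compl)

lemma test_iter_pd: "test f \<Longrightarrow> test (iter_pd is f)"
  unfolding test_def[of f]
  by (elim conjE, erule testI[OF smooth_iter_pd], assumption)
     (rule iter_pd_zero_outside[OF closed_supp[of f]], auto simp: zero_outside_supp)

lemma test_mult: "smooth g \<Longrightarrow> test f \<Longrightarrow> test (\<lambda>x. g x * f x)"
  using testI[OF smooth_mult, of g f "supp f"] by (auto simp: test_def zero_outside_supp)

lemma test_bounded:
  assumes "test f"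
  obtains M where "0 \<le> M" "\<And>x. norm (f x) \<le> M"
proof -
  have "bounded (f ` supp f)"
    using assms
    by (intro compact_imp_bounded compact_continuous_image
        continuous_on_subset[OF smooth_continuous]) (auto simp: test_def)
  then obtain M where M: "\<And>x. x \<in> supp f \<Longrightarrow> norm (f x) \<le> M"
    unfolding bounded_iff by blast
  have "norm (f x) \<le> max M 0" for x
    using M[of x] zero_outside_supp[of x f] by (cases "x \<in> supp f") auto
  then show ?thesis
    using that[of "max M 0"] by auto
qed

text \<open>One constant \<open>C\<close> and one order \<open>N\<close> serve all pairs in
  \<open>D\<close>. Working with pairs covers both kinds of estimate: all smooth
  \<open>\<phi>\<close> at points of \<open>K\<close>, and all \<open>\<phi>\<close> supported in
  \<open>K\<close> at arbitrary points.\<close>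

definition dominated ::
    "(real^'n::finite) set \<Rightarrow> ('n fn \<times> (real^'n)) set \<Rightarrow> ('n fn \<Rightarrow> 'n fn) \<Rightarrow> bool" where
  "dominated K D P \<longleftrightarrow> (\<exists>C N. 0 \<le> C \<and>
     (\<forall>\<phi> x. (\<phi>, x) \<in> D \<longrightarrow> norm (P \<phi> x) \<le> C * seminorm K N \<phi>))"

lemma dominatedI:
  "0 \<le> C \<Longrightarrow> (\<And>\<phi> x. (\<phi>, x) \<in> D \<Longrightarrow> norm (P \<phi> x) \<le> C * seminorm K N \<phi>) \<Longrightarrow> dominated K D P"
  unfolding dominated_def by blast

lemma dominatedE:
  assumes "dominated K D P"
  obtains C N where "0 \<le> C" "\<And>\<phi> x. (\<phi>, x) \<in> D \<Longrightarrow> norm (P \<phi> x) \<le> C * seminorm K N \<phi>"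
  using assms unfolding dominated_def by blast

lemma dominated_cong:
  "(\<And>\<phi> x. (\<phi>, x) \<in> D \<Longrightarrow> P \<phi> x = Q \<phi> x) \<Longrightarrow> dominated K D Q \<Longrightarrow> dominated K D P"
  by (simp add: dominated_def cong: imp_cong)

lemma dominated_zero: "dominated K D (\<lambda>\<phi> x. 0)"
  by (rule dominatedI[of 0]) auto

lemma dominated_iter_pd: "compact K \<Longrightarrow> dominated K {(\<phi>, x). smooth \<phi> \<and> x \<in> K} (iter_pd is)"
  by (rule dominatedI[of 1 _ _ _ "length is"]) (auto intro: norm_iter_pd_le_seminorm)

lemma dominated_add:
  assumes "compact K" "K \<noteq> {}" "\<And>\<phi> x. (\<phi>, x) \<in> D \<Longrightarrow> smooth \<phi>"
    and "dominated K D P" "dominated K D Q"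
  shows "dominated K D (\<lambda>\<phi> x. P \<phi> x + Q \<phi> x)"
proof -
  obtain C1 N1 where P: "0 \<le> C1" "\<And>\<phi> x. (\<phi>, x) \<in> D \<Longrightarrow> norm (P \<phi> x) \<le> C1 * seminorm K N1 \<phi>"
    using dominatedE[OF assms(4)] by blast
  obtain C2 N2 where Q: "0 \<le> C2" "\<And>\<phi> x. (\<phi>, x) \<in> D \<Longrightarrow> norm (Q \<phi> x) \<le> C2 * seminorm K N2 \<phi>"
    using dominatedE[OF assms(5)] by blast
  show ?thesis
  proof (rule dominatedI[of "C1 + C2" _ _ _ "max N1 N2"])
    fix \<phi> x assume D: "(\<phi>, x) \<in> D"
    have "norm (P \<phi> x + Q \<phi> x) \<le> C1 * seminorm K N1 \<phi> + C2 * seminorm K N2 \<phi>"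
      by (intro norm_triangle_mono P Q D)
    also have "\<dots> \<le> C1 * seminorm K (max N1 N2) \<phi> + C2 * seminorm K (max N1 N2) \<phi>"
      using assms(1,2) assms(3)[OF D] P(1) Q(1)
      by (intro add_mono mult_left_mono seminorm_mono) auto
    finally show "norm (P \<phi> x + Q \<phi> x) \<le> (C1 + C2) * seminorm K (max N1 N2) \<phi>"
      by (simp add: algebra_simps)
  qed (use P(1) Q(1) in simp)
qed

lemma dominated_sum:
  assumes "compact K" "K \<noteq> {}" "\<And>\<phi> x. (\<phi>, x) \<in> D \<Longrightarrow> smooth \<phi>"
    and "\<And>a. a \<in> A \<Longrightarrow> dominated K D (P a)"
  shows "dominated K D (\<lambda>\<phi> x. \<Sum>a\<in>A. P a \<phi> x)"
  using assms(4)
  by (induction A rule: infinite_finite_induct)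
     (auto intro: dominated_zero dominated_add[OF assms(1-3)])

lemma dominated_sum_list:
  assumes "compact K" "K \<noteq> {}" "\<And>\<phi> x. (\<phi>, x) \<in> D \<Longrightarrow> smooth \<phi>"
    and "\<And>l. l \<in> set ls \<Longrightarrow> dominated K D (P l)"
  shows "dominated K D (\<lambda>\<phi> x. \<Sum>l\<leftarrow>ls. P l \<phi> x)"
  using assms(4)
  by (induction ls) (auto intro: dominated_zero dominated_add[OF assms(1-3)])

lemma dominated_mult:
  assumes "\<And>\<phi> x. (\<phi>, x) \<in> D \<Longrightarrow> norm (g x) \<le> M" "0 \<le> M" "dominated K D P"
  shows "dominated K D (\<lambda>\<phi> x. g x * P \<phi> x)"
proof -
  obtain C N where P: "0 \<le> C" "\<And>\<phi> x. (\<phi>, x) \<in> D \<Longrightarrow> norm (P \<phi> x) \<le> C * seminorm K N \<phi>"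
    using dominatedE[OF assms(3)] by blast
  show ?thesis
  proof (rule dominatedI[of "M * C" _ _ _ N])
    show "norm (g x * P \<phi> x) \<le> (M * C) * seminorm K N \<phi>" if "(\<phi>, x) \<in> D" for \<phi> x
      using mult_mono[OF assms(1)[OF that] P(2)[OF that]] assms(2) by (simp add: norm_mult mult.assoc)
  qed (use assms(2) P(1) in simp)
qed

text \<open>Since the derivatives of a coordinate are constants 0 or 1, commuting it past
  \<open>iter_pd\<close> leaves pure derivatives as correction terms. The list \<open>ls\<close> is
  independent of \<open>g\<close>, which keeps the estimates uniform.\<close>

lemma iter_pd_coord_mult:
  "\<exists>ls. \<forall>g. smooth g \<longrightarrow> iter_pd is (\<lambda>x. of_real (x $ j) * g x) =
     (\<lambda>x. of_real (x $ j) * iter_pd is g x + (\<Sum>l\<leftarrow>ls. iter_pd l g x))"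
proof (induction "is")
  case Nil
  show ?case
    by (rule exI[of _ "[]"]) simp
next
  case (Cons i "is")
  then obtain ls where ls: "\<And>g. smooth g \<Longrightarrow> iter_pd is (\<lambda>x. of_real (x $ j) * g x) =
     (\<lambda>x. of_real (x $ j) * iter_pd is g x + (\<Sum>l\<leftarrow>ls. iter_pd l g x))"
    by blast
  \<comment> \<open>Differentiating the factor \<open>x $ j\<close> itself contributes
    \<open>is\<close> when \<open>i = j\<close>; every earlier correction term is differentiated
    once more.\<close>
  let ?ls = "(if i = j then [is] else []) @ map ((#) i) ls"
  have "iter_pd (i # is) (\<lambda>x. of_real (x $ j) * g x) =
     (\<lambda>x. of_real (x $ j) * iter_pd (i # is) g x + (\<Sum>l\<leftarrow>?ls. iter_pd l g x))"
    if g: "smooth g" for g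
  proof -
    have "has_pd i (\<lambda>x. \<Sum>l\<leftarrow>ls. iter_pd l g x) (\<lambda>x. \<Sum>l\<leftarrow>ls. dpart i (iter_pd l g) x)"
      by (induction ls) (auto intro!: has_pd_const has_pd_add smooth_has_pd smooth_iter_pd g)
    then have "has_pd i (\<lambda>x. of_real (x $ j) * iter_pd is g x + (\<Sum>l\<leftarrow>ls. iter_pd l g x))
       (\<lambda>x. (of_real (x $ j) * dpart i (iter_pd is g) x + of_bool (i = j) * iter_pd is g x)
          + (\<Sum>l\<leftarrow>ls. dpart i (iter_pd l g) x))"
      by (intro has_pd_add has_pd_mult has_pd_coord smooth_has_pd smooth_iter_pd g)
    then show ?thesis
      by (auto simp: ls[OF g] dpart_eq o_def fun_eq_iff)
  qed
  then show ?case
    by (intro exI[of _ ?ls]) simp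
qed

text \<open>Multiplication by the monomial with exponents \<open>count_list js\<close>, kept as a
  list so that coordinates can be peeled off one at a time and paired with \<open>iter_pd\<close>
  along the same list.\<close>

definition mulc :: "'n::finite list \<Rightarrow> 'n fn \<Rightarrow> 'n fn" where
  "mulc js f = (\<lambda>x. of_real (prod_list (map (\<lambda>i. x $ i) js)) * f x)"

lemma mulc_Nil [simp]: "mulc [] f = f"
  by (simp add: mulc_def)

lemma mulc_Cons [simp]: "mulc (j # js) f = (\<lambda>x. of_real (x $ j) * mulc js f x)"
  by (simp add: mulc_def mult.assoc)

lemma smooth_mulc: "smooth f \<Longrightarrow> smooth (mulc js f)"
  by (induction js) (auto intro: smooth_mult smooth_coord)

lemma test_mulc: "test f \<Longrightarrow> test (mulc js f)"
  by (induction js) (auto intro: test_mult smooth_coord)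

text \<open>Each coordinate is bounded on the compact set \<open>K\<close>, and commuting it past
  the derivatives leaves finitely many derivatives of \<open>mulc js \<phi>\<close>, which the
  induction covers because \<open>is\<close> is arbitrary.\<close>

lemma dominated_iter_pd_mulc:
  assumes K: "compact K" "K \<noteq> {}"
  shows "dominated K {(\<phi>, x). smooth \<phi> \<and> x \<in> K} (\<lambda>\<phi>. iter_pd is (mulc js \<phi>))"
proof (induction js arbitrary: "is")
  case Nil
  show ?case
    using dominated_iter_pd[OF K(1)] by simp
next
  case (Cons j js)
  obtain ls where ls: "\<And>g. smooth g \<Longrightarrow> iter_pd is (\<lambda>x. of_real (x $ j) * g x) =
     (\<lambda>x. of_real (x $ j) * iter_pd is g x + (\<Sum>l\<leftarrow>ls. iter_pd l g x))"
    using iter_pd_coord_mult by blast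
  obtain M where M: "0 < M" "\<And>x. x \<in> K \<Longrightarrow> norm x \<le> M"
    using compact_imp_bounded[OF K(1)] unfolding bounded_pos by blast
  have "norm (complex_of_real (x $ j)) \<le> M" if "x \<in> K" for x
    using order_trans[OF component_le_norm_cart M(2)[OF that]] by simp
  then have "dominated K {(\<phi>, x). smooth \<phi> \<and> x \<in> K} (\<lambda>\<phi> x. of_real (x $ j) * iter_pd is (mulc js \<phi>) x
        + (\<Sum>l\<leftarrow>ls. iter_pd l (mulc js \<phi>) x))"
    using M(1) by (intro dominated_add[OF K] dominated_mult dominated_sum_list[OF K] Cons) auto
  then show ?case
    by (rule dominated_cong[rotated]) (simp add: ls smooth_mulc)
qed

subsection \<open>Differentiation under the integral and integration by parts\<close>

lemma has_vector_derivative_at_0_iff: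
  fixes f :: "real \<Rightarrow> 'a::real_normed_vector"
  shows "(f has_vector_derivative D) (at 0) \<longleftrightarrow> ((\<lambda>s. (f s - f 0) /\<^sub>R s) \<longlongrightarrow> D) (at 0)"
proof -
  have "((\<lambda>s. (f s - f 0) /\<^sub>R s) \<longlongrightarrow> D) (at 0) \<longleftrightarrow>
      ((\<lambda>s. norm ((f s - f 0) /\<^sub>R s - D)) \<longlongrightarrow> 0) (at 0)"
    by (simp add: tendsto_norm_zero_iff LIM_zero_iff)
  also have "\<dots> \<longleftrightarrow> ((\<lambda>s. norm (f s - f 0 - (s - 0) *\<^sub>R D) / norm (s - 0)) \<longlongrightarrow> 0) (at 0)"
  proof (intro filterlim_cong refl)
    show "\<forall>\<^sub>F s in at 0. norm ((f s - f 0) /\<^sub>R s - D) = norm (f s - f 0 - (s - 0) *\<^sub>R D) / norm (s - 0)"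
      unfolding eventually_at_filter
    proof (intro always_eventually allI impI)
      fix s :: real assume "s \<noteq> 0"
      then have "(f s - f 0) /\<^sub>R s - D = (f s - f 0 - s *\<^sub>R D) /\<^sub>R s"
        by (simp add: scaleR_diff_right)
      then show "norm ((f s - f 0) /\<^sub>R s - D) = norm (f s - f 0 - (s - 0) *\<^sub>R D) / norm (s - 0)"
        by (simp add: divide_inverse mult.commute)
    qed
  qed
  also have "\<dots> \<longleftrightarrow> (f has_vector_derivative D) (at 0)"
    unfolding has_vector_derivative_def has_derivative_iff_norm
    by (simp add: bounded_linear_scaleR_left)
  finally show ?thesis ..
qed

text \<open>The mean value inequality bounds the difference quotients by \<open>g\<close>; dominated
  convergence along sequences tending to 0 then gives the derivative.\<close>

lemma has_vector_derivative_integral: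
  fixes F F' :: "real \<Rightarrow> 'a \<Rightarrow> complex"
  assumes deriv: "\<And>s x. \<bar>s\<bar> \<le> 1 \<Longrightarrow> ((\<lambda>s. F s x) has_vector_derivative F' s x) (at s)"
    and int: "\<And>s. integrable M (F s)"
    and meas: "F' 0 \<in> borel_measurable M"
    and bnd: "\<And>s x. \<bar>s\<bar> \<le> 1 \<Longrightarrow> norm (F' s x) \<le> g x"
    and g: "integrable M g"
  shows "((\<lambda>s. integral\<^sup>L M (F s)) has_vector_derivative integral\<^sup>L M (F' 0)) (at 0)"
  unfolding has_vector_derivative_at_0_iff tendsto_at_iff_sequentially
proof (intro allI impI)
  fix X :: "nat \<Rightarrow> real" assume X: "\<forall>i. X i \<in> UNIV - {0}" "X \<longlonglongrightarrow> 0"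
  define Q where "Q s x = (F s x - F 0 x) /\<^sub>R s" for s x
  have bQ: "norm (Q s x) \<le> g x" if "\<bar>s\<bar> \<le> 1" "s \<noteq> 0" for s x
  proof -
    have "norm (F s x - F 0 x) \<le> g x * norm (s - 0)"
    proof (rule differentiable_bound[of "{-1..1}" "\<lambda>s. F s x" "\<lambda>s h. h *\<^sub>R F' s x"])
      fix r :: real assume "r \<in> {-1..1}"
      then have r: "\<bar>r\<bar> \<le> 1" by auto
      show "((\<lambda>s. F s x) has_derivative (\<lambda>h. h *\<^sub>R F' r x)) (at r within {-1..1})"
        using deriv[OF r] has_derivative_at_withinI unfolding has_vector_derivative_def by blast
      show "onorm (\<lambda>h. h *\<^sub>R F' r x) \<le> g x"
        using bnd[OF r] by (intro onorm_le) (simp add: mult.commute mult_left_mono)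
    qed (use that in auto)
    moreover have "norm (Q s x) = norm (F s x - F 0 x) / \<bar>s\<bar>"
      by (simp add: Q_def divide_inverse mult.commute)
    ultimately show ?thesis
      using that by (simp add: pos_divide_le_eq)
  qed
  \<comment> \<open>The quotients are dominated only for \<open>\<bar>s\<bar> \<le> 1\<close>, hence
    the passage to a tail of the sequence.\<close>
  obtain n0 where n0: "\<And>n. n \<ge> n0 \<Longrightarrow> \<bar>X n\<bar> < 1"
    using LIMSEQ_D[OF X(2), of 1] by auto
  have "(\<lambda>n. integral\<^sup>L M (Q (X (n + n0)))) \<longlonglongrightarrow> integral\<^sup>L M (F' 0)"
  proof (rule integral_dominated_convergence[where w = g])
    show "AE x in M. (\<lambda>n. Q (X (n + n0)) x) \<longlonglongrightarrow> F' 0 x"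
    proof (rule AE_I2)
      fix x
      have "((\<lambda>s. Q s x) \<longlongrightarrow> F' 0 x) (at 0)"
        using deriv[of 0 x] unfolding has_vector_derivative_at_0_iff Q_def by simp
      then have "(\<lambda>n. Q (X n) x) \<longlonglongrightarrow> F' 0 x"
        using X unfolding tendsto_at_iff_sequentially o_def by blast
      then show "(\<lambda>n. Q (X (n + n0)) x) \<longlonglongrightarrow> F' 0 x"
        by (rule LIMSEQ_ignore_initial_segment)
    qed
    show "AE x in M. norm (Q (X (n + n0)) x) \<le> g x" for n
      using n0[of "n + n0"] X(1) by (intro AE_I2 bQ) auto
    show "Q (X (n + n0)) \<in> borel_measurable M" for n
      unfolding Q_def using int[THEN borel_measurable_integrable] by measurable
  qed (use meas g in auto)
  then have "(\<lambda>n. integral\<^sup>L M (Q (X n))) \<longlonglongrightarrow> integral\<^sup>L M (F' 0)"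
    by (rule LIMSEQ_offset)
  moreover have "integral\<^sup>L M (Q s) = (integral\<^sup>L M (F s) - integral\<^sup>L M (F 0)) /\<^sub>R s" for s
    unfolding Q_def using int by simp
  ultimately show "((\<lambda>s. (integral\<^sup>L M (F s) - integral\<^sup>L M (F 0)) /\<^sub>R s) \<circ> X) \<longlonglongrightarrow> integral\<^sup>L M (F' 0)"
    by (simp add: o_def)
qed

section \<open>Integration by parts against test functions\<close>

lemma integrable_compact_support:
  fixes f :: "'n::finite fn"
  assumes "continuous_on UNIV f" "compact K" "\<And>x. x \<notin> K \<Longrightarrow> f x = 0"
  shows "integrable lborel f"
proof -
  have "integrable lborel (\<lambda>x. indicator K x *\<^sub>R f x)"
    by (intro borel_integrable_compact assms continuous_on_subset[OF assms(1)]) auto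
  also have "(\<lambda>x. indicator K x *\<^sub>R f x) = f"
    using assms(3) by (auto simp: fun_eq_iff indicator_def)
  finally show ?thesis .
qed

lemma integrable_test: "test f \<Longrightarrow> integrable lborel f"
  by (rule integrable_compact_support[of _ "supp f"])
     (auto simp: test_def smooth_continuous zero_outside_supp)

lemma integrable_indicator_cball:
  "integrable lborel (\<lambda>x::real^'n::finite. c * indicator (cball 0 R) x :: real)"
  by (intro integrable_mult_right integrable_real_indicator emeasure_bounded_finite) auto

lemma test_supp_cball:
  assumes "test f"
  obtains R where "0 < R" "\<And>x. R < norm x \<Longrightarrow> f x = 0"
proof -
  have "bounded (supp f)"
    using assms by (auto simp: test_def compact_imp_bounded)
  then obtain R where "0 < R" "\<And>x. x \<in> supp f \<Longrightarrow> norm x \<le> R"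
    unfolding bounded_pos by blast
  then show ?thesis
    using that[of R] zero_outside_supp[of _ f] by force
qed

text \<open>The integral of \<open>H (x + s e\<^sub>i)\<close> over \<open>x\<close> does not depend on \<open>s\<close>; differentiate at \<open>s = 0\<close>.\<close>

lemma integral_dpart_test:
  assumes H: "test H"
  shows "(LINT x|lborel. dpart i H x) = 0"
proof -
  have sm: "smooth H" and tD: "test (dpart i H)"
    using H test_iter_pd[OF H, of "[i]"] by (auto simp: test_def)
  obtain B where B: "0 \<le> B" "\<And>x. norm (dpart i H x) \<le> B"
    using test_bounded[OF tD] by blast
  obtain R where R: "0 < R" "\<And>x. R < norm x \<Longrightarrow> dpart i H x = 0"
    using test_supp_cball[OF tD] by blast
  have cH: "H \<in> borel_measurable borel" and cD: "dpart i H \<in> borel_measurable borel"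
    using sm smooth_dpart[OF sm]
    by (auto intro!: borel_measurable_continuous_onI smooth_continuous)
  have tr: "Measure_Space.distr lborel borel ((+) c) = (lborel :: (real^'a) measure)" for c
    by (rule lborel_distr_plus)
  have int: "integrable lborel (\<lambda>x. H (x + s *\<^sub>R axis i 1))" for s
  proof -
    have "integrable (Measure_Space.distr lborel borel ((+) (s *\<^sub>R axis i 1))) H"
      unfolding tr by (rule integrable_test[OF H])
    then show ?thesis
      using cH by (subst (asm) integrable_distr_eq) (auto simp: add.commute)
  qed
  have const: "(LINT x|lborel. H (x + s *\<^sub>R axis i 1)) = (LINT x|lborel. H x)" for s
  proof -
    have "(LINT x|lborel. H x) = (LINT x|Measure_Space.distr lborel borel ((+) (s *\<^sub>R axis i 1)). H x)"
      unfolding tr ..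
    also have "\<dots> = (LINT x|lborel. H (x + s *\<^sub>R axis i 1))"
      using cH by (subst integral_distr) (auto simp: add.commute)
    finally show ?thesis ..
  qed
  have "((\<lambda>s. LINT x|lborel. H (x + s *\<^sub>R axis i 1)) has_vector_derivative
      (LINT x|lborel. dpart i H (x + 0 *\<^sub>R axis i 1))) (at 0)"
  \<comment> \<open>For \<open>\<bar>s\<bar> \<le> 1\<close>, the translate of a function vanishing
    beyond radius \<open>R\<close> vanishes beyond \<open>R + 1\<close>.\<close>
  proof (rule has_vector_derivative_integral[where g = "\<lambda>x. B * indicator (cball 0 (R + 1)) x"])
    show "((\<lambda>s. H (x + s *\<^sub>R axis i 1)) has_vector_derivative dpart i H (x + s *\<^sub>R axis i 1)) (at s)"
      for s x by (rule has_pd_line[OF smooth_has_pd[OF sm]])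
    show "norm (dpart i H (x + s *\<^sub>R axis i 1)) \<le> B * indicator (cball 0 (R + 1)) x"
      if "\<bar>s\<bar> \<le> 1" for s x
    proof (cases "x \<in> cball 0 (R + 1)")
      case False
      have "norm x \<le> norm (x + s *\<^sub>R axis i 1) + norm (s *\<^sub>R axis i (1::real))"
        using norm_triangle_ineq4[of "x + s *\<^sub>R axis i 1" "s *\<^sub>R axis i (1::real)"] by simp
      then have "R < norm (x + s *\<^sub>R axis i 1)"
        using False that by (simp add: norm_axis_1)
      then show ?thesis
        using R(2) B(1) by (simp add: indicator_def)
    qed (use B(2) in auto)
    show "integrable lborel (\<lambda>x::real^'a. B * indicator (cball 0 (R + 1)) x)"
      by (rule integrable_indicator_cball)
  qed (use int cD in auto)
  then have "((\<lambda>s::real. LINT x|lborel. H x) has_vector_derivative (LINT x|lborel. dpart i H x)) (at 0)"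
    by (simp add: const)
  then show ?thesis
    using vector_derivative_unique_at[OF _ has_vector_derivative_const] by blast
qed

lemma integral_by_parts:
  assumes G: "test G" and F: "smooth F"
  shows "(LINT x|lborel. G x * dpart i F x) = - (LINT x|lborel. dpart i G x * F x)"
proof -
  have sG: "smooth G" and tG': "test (dpart i G)"
    using G test_iter_pd[OF G, of "[i]"] by (auto simp: test_def)
  have t1: "test (\<lambda>x. G x * dpart i F x)" and t2: "test (\<lambda>x. dpart i G x * F x)"
    using test_mult[OF smooth_dpart[OF F] G] test_mult[OF F tG'] by (simp_all add: mult.commute)
  have "test (\<lambda>x. G x * F x)"
    using test_mult[OF F G] by (simp add: mult.commute)
  then have "0 = (LINT x|lborel. dpart i (\<lambda>x. G x * F x) x)"
    by (simp add: integral_dpart_test)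
  also have "\<dots> = (LINT x|lborel. G x * dpart i F x + dpart i G x * F x)"
    by (simp add: dpart_mult sG F)
  also have "\<dots> = (LINT x|lborel. G x * dpart i F x) + (LINT x|lborel. dpart i G x * F x)"
    by (intro Bochner_Integration.integral_add integrable_test t1 t2)
  finally show ?thesis
    by (simp add: eq_neg_iff_add_eq_0)
qed

text \<open>The outermost derivative on \<open>F\<close> is moved first and so becomes the innermost
  one on \<open>G\<close>; this reverses the list.\<close>

lemma integral_by_parts_iter:
  assumes "test G" "smooth F"
  shows "(LINT x|lborel. G x * iter_pd is F x) =
    (-1) ^ length is * (LINT x|lborel. iter_pd (rev is) G x * F x)"
  using assms(1)
proof (induction "is" arbitrary: G)
  case (Cons i "is")
  have "test (dpart i G)"
    using test_iter_pd[OF Cons.prems, of "[i]"] by simp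
  then show ?case
    using integral_by_parts[OF Cons.prems smooth_iter_pd[OF assms(2)], of i "is"] Cons.IH[of "dpart i G"]
    by (simp add: iter_pd_append)
qed simp

subsection \<open>Cutoff functions\<close>

text \<open>Admitting all polynomials \<open>p\<close> makes the family closed under
  differentiation: with \<open>u = 1/s\<close>, the derivative of \<open>p(u) exp(-u)\<close> in
  \<open>s\<close> is \<open>u^2 (p - p')(u) exp(-u)\<close>.\<close>

definition flat :: "real poly \<Rightarrow> real \<Rightarrow> real" where
  "flat p s = (if s \<le> 0 then 0 else poly p (1 / s) * exp (- (1 / s)))"

text \<open>The free power \<open>y ^ k\<close> absorbs the degree shift in the induction:
  \<open>pCons a p\<close> splits into the term \<open>a * y ^ k\<close> and the same statement for
  \<open>p\<close> with \<open>Suc k\<close>.\<close>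

lemma tendsto_poly_mult_exp_neg: "((\<lambda>y. y ^ k * poly p y * exp (- y)) \<longlongrightarrow> (0::real)) at_top"
proof (induction p arbitrary: k)
  case (pCons a p)
  have "((\<lambda>y. a * (y ^ k / exp y) + y ^ Suc k * poly p y * exp (- y)) \<longlongrightarrow> a * 0 + 0) at_top"
    by (intro tendsto_intros tendsto_power_div_exp_0 pCons)
  then show ?case
    by (simp add: algebra_simps exp_minus divide_inverse)
qed simp

lemma flat_tendsto_0: "(flat p \<longlongrightarrow> 0) (at 0)"
  unfolding filterlim_at_split
proof
  have "\<forall>\<^sub>F s in at_left 0. flat p s = 0"
    by (auto simp: flat_def eventually_at_filter)
  then show "(flat p \<longlongrightarrow> 0) (at_left 0)"
    by (rule tendsto_eventually)
  have "((\<lambda>y. poly p y * exp (- y)) \<longlongrightarrow> 0) at_top"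
    using tendsto_poly_mult_exp_neg[of 0 p] by simp
  from filterlim_compose[OF this filterlim_inverse_at_top_right]
  have "((\<lambda>s. poly p (1 / s) * exp (- (1 / s))) \<longlongrightarrow> 0) (at_right 0)"
    by (simp add: inverse_eq_divide)
  moreover have "\<forall>\<^sub>F s in at_right 0. poly p (1 / s) * exp (- (1 / s)) = flat p s"
    by (auto simp: flat_def eventually_at_filter)
  ultimately show "(flat p \<longlongrightarrow> 0) (at_right 0)"
    using tendsto_cong by force
qed

lemma flat_has_derivative:
  "(flat p has_real_derivative flat ([:0, 0, 1:] * (p - pderiv p)) s) (at s)"
proof (cases s "0::real" rule: linorder_cases)
  case less
  have "((\<lambda>s. 0::real) has_real_derivative 0) (at s)"
    by simp
  then have "(flat p has_real_derivative 0) (at s)"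
    by (rule has_field_derivative_transform_within_open[of _ _ _ "{..<0}"])
       (use less in \<open>auto simp: flat_def\<close>)
  then show ?thesis
    using less by (simp add: flat_def)
next
  case equal
  \<comment> \<open>The difference quotient at 0 lies again in the family, with \<open>p\<close>
    multiplied by the variable, so it tends to 0.\<close>
  have "(\<lambda>h. flat p h / h) = flat (pCons 0 p)"
    by (auto simp: flat_def fun_eq_iff)
  then have "((\<lambda>h. flat p h / h) \<longlongrightarrow> 0) (at 0)"
    by (simp add: flat_tendsto_0)
  then show ?thesis
    unfolding equal DERIV_def by (simp add: flat_def)
next
  case greater
  have "((\<lambda>s. poly p (1 / s) * exp (- (1 / s))) has_real_derivative
      flat ([:0, 0, 1:] * (p - pderiv p)) s) (at s)"
    using greater
    by (auto intro!: derivative_eq_intros poly_DERIV simp: flat_def field_simps power2_eq_square)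
  then show ?thesis
    by (rule has_field_derivative_transform_within_open[of _ _ _ "{0<..}"])
       (use greater in \<open>auto simp: flat_def\<close>)
qed

lemma smooth_flat: "smooth (\<lambda>x::real^'n::finite. complex_of_real (flat p (a + b * x $ j)))"
proof (rule smooth_coinduct[of _ "{\<lambda>x. of_real (c * flat p (a + b * x $ j)) |c p. True}"])
  show "(\<lambda>x. complex_of_real (flat p (a + b * x $ j))) \<in>
      {\<lambda>x::real^'n. of_real (c * flat p (a + b * x $ j)) |c p. True}"
    by (auto intro!: exI[of _ 1] exI[of _ p])
next
  fix g :: "'n fn" and i
  assume "g \<in> {\<lambda>x. of_real (c * flat p (a + b * x $ j)) |c p. True}"
  then obtain c p where g: "g = (\<lambda>x. of_real (c * flat p (a + b * x $ j)))"
    by blast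
  have "continuous_on UNIV (flat p)"
    using flat_has_derivative by (meson DERIV_continuous_on)
  then have "continuous_on UNIV (\<lambda>x::real^'n. flat p (a + b * x $ j))"
    by (rule continuous_on_compose2) (auto intro!: continuous_intros)
  then show "continuous_on UNIV g"
    unfolding g by (intro continuous_intros)
  let ?q = "[:0, 0, 1:] * (p - pderiv p)"
  have "has_pd i g (\<lambda>x. of_real ((c * b * of_bool (i = j)) * flat ?q (a + b * x $ j)))"
    unfolding has_pd_def
  proof
    fix x :: "real^'n"
    have "((\<lambda>t. flat p (a + b * (x $ j + t * of_bool (i = j)))) has_real_derivative
        flat ?q (a + b * (x $ j + 0 * of_bool (i = j))) * (b * of_bool (i = j))) (at 0)"
      by (rule DERIV_chain2[OF flat_has_derivative]) (auto intro!: derivative_eq_intros)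
    then have "((\<lambda>t. c * flat p (a + b * (x $ j + t * of_bool (i = j)))) has_real_derivative
        c * (flat ?q (a + b * (x $ j + 0 * of_bool (i = j))) * (b * of_bool (i = j)))) (at 0)"
      by (rule DERIV_cmult)
    then have "((\<lambda>t. complex_of_real (c * flat p (a + b * (x $ j + t * of_bool (i = j))))) has_vector_derivative
        of_real (c * (flat ?q (a + b * (x $ j + 0 * of_bool (i = j))) * (b * of_bool (i = j))))) (at 0)"
      by (intro has_vector_derivative_of_real)
         (simp only: has_real_derivative_iff_has_vector_derivative)
    moreover have "(x + t *\<^sub>R axis i 1) $ j = x $ j + t * of_bool (i = j)" for t
      by (auto simp: axis_def)
    ultimately show "((\<lambda>t. g (x + t *\<^sub>R axis i 1)) has_vector_derivative
        of_real ((c * b * of_bool (i = j)) * flat ?q (a + b * x $ j))) (at 0)"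
      by (simp only: g) (simp add: mult_ac)
  qed
  then show "\<exists>g'\<in>{\<lambda>x. of_real (c * flat p (a + b * x $ j)) |c p. True}. has_pd i g g'"
    by blast
qed

text \<open>The usual smooth transition between 0 and 1; the denominator is positive because
  \<open>s\<close> and \<open>1 - s\<close> are not both nonpositive.\<close>

definition step :: "real \<Rightarrow> real" where
  "step s = flat 1 s * inverse (flat 1 s + flat 1 (1 - s))"

lemma smooth_step: "smooth (\<lambda>x::real^'n::finite. complex_of_real (step (a + b * x $ j)))"
proof -
  have "flat 1 s + flat 1 (1 - s) \<noteq> 0" for s
    by (auto simp: flat_def add_pos_pos less_imp_neq[THEN not_sym])
  then have nz: "complex_of_real (flat 1 s) + complex_of_real (flat 1 (1 - s)) \<noteq> 0" for s
    by (metis of_real_add of_real_eq_0_iff)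
  have "smooth (\<lambda>x. complex_of_real (flat 1 (a + b * x $ j)) *
      inverse (complex_of_real (flat 1 (a + b * x $ j)) + of_real (flat 1 ((1 - a) + (- b) * x $ j))))"
    using nz by (intro smooth_mult smooth_inverse smooth_add smooth_flat) (simp add: algebra_simps)
  then show ?thesis
    by (simp add: step_def algebra_simps)
qed

lemma step_eq_0: "s \<le> 0 \<Longrightarrow> step s = 0"
  and step_eq_1: "1 \<le> s \<Longrightarrow> step s = 1"
  by (auto simp: step_def flat_def)

lemma cutoff_exists:
  assumes "compact (K :: (real^'n::finite) set)"
  obtains \<eta> U where "test \<eta>" "open U" "K \<subseteq> U" "\<And>x. x \<in> U \<Longrightarrow> \<eta> x = 1"
proof -
  obtain R where R: "0 < R" "\<And>x. x \<in> K \<Longrightarrow> norm x < R"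
    using compact_imp_bounded[OF assms] unfolding bounded_pos_less by blast
  \<comment> \<open>In each coordinate both factors are 1 for
    \<open>\<bar>x $ j\<bar> \<le> R\<close>, and one of them is 0 once
    \<open>\<bar>x $ j\<bar> \<ge> R + 1\<close>. So the plateau contains \<open>ball 0 R\<close>
    and the support lies in a cube.\<close>
  define \<eta> :: "'n fn" where
    "\<eta> x = (\<Prod>j\<in>UNIV. of_real (step (R + 1 + 1 * x $ j)) * of_real (step (R + 1 + (-1) * x $ j)))" for x
  have "smooth \<eta>"
    unfolding \<eta>_def by (intro smooth_prod smooth_mult smooth_step)
  moreover have "\<eta> x = 0" if "x \<notin> cbox (\<chi> i. - (R + 1)) (\<chi> i. R + 1)" for x
  proof -
    have "\<exists>j. \<not> (- (R + 1) \<le> x $ j \<and> x $ j \<le> R + 1)"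
      using that by (auto simp: mem_box_cart)
    then obtain j where "x $ j < - (R + 1) \<or> R + 1 < x $ j"
      by (meson not_le)
    then have "step (R + 1 + 1 * x $ j) = 0 \<or> step (R + 1 + (-1) * x $ j) = 0"
      by (auto intro!: step_eq_0)
    then show ?thesis
      unfolding \<eta>_def by (intro prod_zero) auto
  qed
  ultimately have "test \<eta>"
    by (rule testI[OF _ compact_cbox])
  moreover have "\<eta> x = 1" if "x \<in> ball 0 R" for x
  proof -
    have "\<bar>x $ j\<bar> < R" for j
      using component_le_norm_cart[of x j] that by simp
    then have "step (R + 1 + 1 * x $ j) = 1" "step (R + 1 + (-1) * x $ j) = 1" for j
      by (smt (verit) step_eq_1)+
    then show ?thesis
      unfolding \<eta>_def by simp
  qed
  ultimately show ?thesis
    using that[of \<eta> "ball 0 R"] R(2) by (auto simp: subset_iff)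
qed

subsection \<open>Multiplicative convolution operators\<close>

definition vinv :: "real^'n::finite \<Rightarrow> real^'n" where
  "vinv x = (\<chi> i. inverse (x $ i))"

lemma vinv_nth [simp]: "vinv x $ i = inverse (x $ i)"
  by (simp add: vinv_def)

lemma borel_measurable_vec_nth: "(\<lambda>x::real^'n::finite. x $ i) \<in> borel_measurable borel"
  by (intro borel_measurable_continuous_onI continuous_intros)

lemma borel_measurable_vinv: "vinv \<in> borel_measurable (borel :: (real^'n::finite) measure)"
  unfolding borel_measurable_euclidean_space[of vinv] Basis_vec_def
  using borel_measurable_inverse[OF borel_measurable_vec_nth] by (auto simp: inner_axis)

text \<open>Coordinates equal to \<open>0\<close> are inverted to \<open>0\<close>, so \<open>vinv\<close> inverts \<open>x\<close> only off the
  coordinate hyperplanes; an admissible kernel is required to vanish on them.\<close>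

definition admissible :: "'n::finite fn \<Rightarrow> bool" where
  "admissible k \<longleftrightarrow> k \<in> borel_measurable borel \<and>
     (\<exists>R\<ge>0. \<forall>x. R < norm x \<longrightarrow> k x = 0) \<and>
     (\<forall>x i. x $ i = 0 \<longrightarrow> k x = 0) \<and>
     (\<forall>\<gamma>::'n \<Rightarrow> nat. integrable lborel (\<lambda>x. k x * of_real (\<Prod>i\<in>UNIV. vinv x $ i ^ \<gamma> i)))"

lemma admissible_integrable_vinv:
  "admissible k \<Longrightarrow> integrable lborel (\<lambda>x. k x * of_real (\<Prod>i\<in>UNIV. vinv x $ i ^ \<gamma> i))"
  by (simp only: admissible_def)

lemma admissible_measurable: "admissible k \<Longrightarrow> k \<in> borel_measurable borel"
  by (simp add: admissible_def)

lemma admissible_integrable: "admissible k \<Longrightarrow> integrable lborel k"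
  using admissible_integrable_vinv[of k "\<lambda>_. 0"] by simp

text \<open>Differentiating \<open>h (z * vinv x)\<close> in \<open>z\<close> brings out
  \<open>vinv x $ i\<close>; stability under this factor allows \<open>kop\<close> to be
  differentiated indefinitely. The factor raises one exponent of \<open>\<gamma>\<close>, which is
  why admissibility quantifies over all \<open>\<gamma>\<close>.\<close>

lemma admissible_vinv_mult:
  assumes "admissible k"
  shows "admissible (\<lambda>x. of_real (vinv x $ i) * k x)"
proof -
  have prod: "(\<Prod>j\<in>UNIV. vinv x $ j ^ (\<gamma> j + of_bool (j = i))) =
      vinv x $ i * (\<Prod>j\<in>UNIV. vinv x $ j ^ \<gamma> j)" for x :: "real^'a" and \<gamma>
  proof -
    have "vinv x $ j ^ of_bool (j = i) = (if j = i then vinv x $ j else 1)" for j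
      by simp
    then have "(\<Prod>j\<in>UNIV. vinv x $ j ^ of_bool (j = i)) = vinv x $ i"
      by (simp only: prod.delta[OF finite] UNIV_I if_True)
    then show ?thesis
      by (simp add: power_add prod.distrib mult.commute)
  qed
  have "integrable lborel (\<lambda>x. of_real (vinv x $ i) * k x * of_real (\<Prod>j\<in>UNIV. vinv x $ j ^ \<gamma> j))" for \<gamma>
  proof -
    have "integrable lborel (\<lambda>x. k x * of_real (\<Prod>j\<in>UNIV. vinv x $ j ^ (\<gamma> j + of_bool (j = i))))"
      by (rule admissible_integrable_vinv[OF assms])
    then show ?thesis
      unfolding prod of_real_mult by (simp only: mult_ac)
  qed
  moreover have "(\<lambda>x. of_real (vinv x $ i) * k x) \<in> borel_measurable borel"
    using admissible_measurable[OF assms] borel_measurable_vec_nth[of i] unfolding vinv_nth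
    by measurable
  ultimately show ?thesis
    using assms unfolding admissible_def by fastforce
qed

lemma admissible_iter:
  "admissible k \<Longrightarrow> admissible (\<lambda>x. of_real (prod_list (map (\<lambda>i. vinv x $ i) is)) * k x)"
proof (induction "is")
  case (Cons i "is")
  then show ?case
    using admissible_vinv_mult[of "\<lambda>x. of_real (prod_list (map (\<lambda>i. vinv x $ i) is)) * k x" i]
    by (simp add: mult.assoc)
qed simp

text \<open>Multiplicative convolution, with \<open>h (z * vinv x)\<close> standing for
  \<open>h(z/x)\<close>. The Jacobian is carried by the kernel, see \<open>kern\<close>.\<close>

definition kop :: "'n::finite fn \<Rightarrow> 'n fn \<Rightarrow> 'n fn" where
  "kop k h z = (LINT x|lborel. k x * h (z * vinv x))"

lemma borel_measurable_comp_vinv: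
  assumes "smooth h"
  shows "(\<lambda>x. h (z * vinv x)) \<in> borel_measurable borel"
proof -
  have "continuous_on UNIV (\<lambda>v. h (z * v))"
    by (rule continuous_on_compose2[OF smooth_continuous[OF assms]])
       (auto intro!: continuous_intros)
  then show ?thesis
    by (rule borel_measurable_continuous_on[OF _ borel_measurable_vinv])
qed

lemma integrable_kop:
  assumes k: "admissible k" and h: "test h"
  shows "integrable lborel (\<lambda>x. k x * h (z * vinv x))"
proof -
  obtain M where M: "0 \<le> M" "\<And>x. norm (h x) \<le> M"
    using test_bounded[OF h] by blast
  have "integrable lborel (\<lambda>x. M * norm (k x))"
    using admissible_integrable[OF k] by simp
  then show ?thesis
  proof (rule Bochner_Integration.integrable_bound)
    show "(\<lambda>x. k x * h (z * vinv x)) \<in> borel_measurable lborel"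
      using k h borel_measurable_comp_vinv[of h z]
      by (intro borel_measurable_times) (simp_all add: admissible_def test_def)
    show "AE x in lborel. norm (k x * h (z * vinv x)) \<le> norm (M * norm (k x))"
      using M by (intro AE_I2) (simp add: norm_mult abs_mult mult.commute[of M] mult_left_mono)
  qed
qed

lemma norm_kop_le:
  assumes k: "admissible k" and h: "test h" and M: "\<And>x. norm (h x) \<le> M"
  shows "norm (kop k h z) \<le> (LINT x|lborel. norm (k x)) * M"
proof -
  have "norm (kop k h z) \<le> (LINT x|lborel. norm (k x * h (z * vinv x)))"
    unfolding kop_def by (rule integral_norm_bound)
  also have "\<dots> \<le> (LINT x|lborel. norm (k x) * M)"
    using M admissible_integrable[OF k]
    by (intro integral_mono integrable_norm integrable_kop[OF k h])
       (auto simp: norm_mult mult_left_mono)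
  finally show ?thesis
    using admissible_integrable[OF k] by simp
qed

lemma continuous_on_kop:
  assumes k: "admissible k" and h: "test h"
  shows "continuous_on UNIV (kop k h)"
  unfolding continuous_on_sequentially o_def
proof (intro allI impI ballI)
  fix Z and z :: "real^'a" assume "(\<forall>n. Z n \<in> UNIV) \<and> Z \<longlonglongrightarrow> z"
  then have Z: "Z \<longlonglongrightarrow> z" by blast
  obtain M where M: "0 \<le> M" "\<And>x. norm (h x) \<le> M"
    using test_bounded[OF h] by blast
  have sm: "smooth h"
    using h by (simp add: test_def)
  show "(\<lambda>n. kop k h (Z n)) \<longlonglongrightarrow> kop k h z"
    unfolding kop_def
  proof (rule integral_dominated_convergence[where w = "\<lambda>x. M * norm (k x)"])
    show "AE x in lborel. (\<lambda>n. k x * h (Z n * vinv x)) \<longlonglongrightarrow> k x * h (z * vinv x)"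
    proof (intro AE_I2 tendsto_intros)
      fix x
      have "continuous_on UNIV (\<lambda>v. h (v * vinv x))"
        using smooth_continuous[OF smooth_scale[OF sm]] .
      then show "(\<lambda>n. h (Z n * vinv x)) \<longlonglongrightarrow> h (z * vinv x)"
        using continuous_on_tendsto_compose[OF _ Z] by force
    qed
    show "AE x in lborel. norm (k x * h (Z n * vinv x)) \<le> M * norm (k x)" for n
      using M by (intro AE_I2) (simp add: norm_mult abs_mult mult.commute[of M] mult_left_mono)
  qed (use admissible_integrable[OF k] borel_measurable_integrable[OF integrable_kop[OF k h]] in auto)
qed

text \<open>A bound for \<open>dpart i h\<close> times the norm of the modified kernel is an
  integrable majorant that does not depend on the position of \<open>z\<close>, so differentiation
  under the integral applies.\<close>

lemma has_pd_kop:
  assumes k: "admissible k" and h: "test h"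
  shows "has_pd i (kop k h) (kop (\<lambda>x. of_real (vinv x $ i) * k x) (dpart i h))"
  unfolding has_pd_def
proof
  fix z :: "real^'a"
  have sm: "smooth h" and th': "test (dpart i h)"
    using h test_iter_pd[OF h, of "[i]"] by (auto simp: test_def)
  obtain M where M: "0 \<le> M" "\<And>x. norm (dpart i h x) \<le> M"
    using test_bounded[OF th'] by blast
  let ?k = "\<lambda>x. of_real (vinv x $ i) * k x"
  have k': "admissible ?k"
    using k by (rule admissible_vinv_mult)
  have "((\<lambda>s. LINT x|lborel. k x * h ((z + s *\<^sub>R axis i 1) * vinv x)) has_vector_derivative
      (LINT x|lborel. ?k x * dpart i h ((z + 0 *\<^sub>R axis i 1) * vinv x))) (at 0)"
  proof (rule has_vector_derivative_integral[where g = "\<lambda>x. M * norm (?k x)"])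
    show "((\<lambda>s. k x * h ((z + s *\<^sub>R axis i 1) * vinv x)) has_vector_derivative
        ?k x * dpart i h ((z + s *\<^sub>R axis i 1) * vinv x)) (at s)" for s x
    proof -
      have "((\<lambda>s. k x * h ((z + s *\<^sub>R axis i 1) * vinv x)) has_vector_derivative
          k x * (of_real (vinv x $ i) * dpart i h ((z + s *\<^sub>R axis i 1) * vinv x))) (at s)"
        by (rule has_vector_derivative_mult_right)
           (rule has_pd_line[OF has_pd_scale[OF smooth_has_pd[OF sm]]])
      then show ?thesis
        by (simp only: mult_ac)
    qed
    show "norm (?k x * dpart i h ((z + s *\<^sub>R axis i 1) * vinv x)) \<le> M * norm (?k x)" for s x
      using M(2) by (subst norm_mult) (simp only: mult.commute[of M] mult_left_mono norm_ge_zero)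
    show "integrable lborel (\<lambda>x. M * norm (?k x))"
      using admissible_integrable[OF k'] by simp
    show "(\<lambda>x. ?k x * dpart i h ((z + 0 *\<^sub>R axis i 1) * vinv x)) \<in> borel_measurable lborel"
      by (rule borel_measurable_integrable[OF integrable_kop[OF k' th']])
  qed (rule integrable_kop[OF k h])
  then show "((\<lambda>t. kop k h (z + t *\<^sub>R axis i 1)) has_vector_derivative kop ?k (dpart i h) z) (at 0)"
    by (simp add: kop_def)
qed

lemma smooth_kop:
  assumes "admissible k" "test h"
  shows "smooth (kop k h)"
proof (rule smooth_coinduct[of _ "{kop k h |k h. admissible k \<and> test h}"])
  fix g i assume "g \<in> {kop k h |k h. admissible k \<and> test h}"
  then obtain k h where g: "g = kop k h" and kh: "admissible k" "test h"
    by blast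
  have "test (dpart i h)"
    using test_iter_pd[OF kh(2), of "[i]"] by simp
  then show "\<exists>g'\<in>{kop k h |k h. admissible k \<and> test h}. has_pd i g g'"
    using has_pd_kop[OF kh, of i] admissible_vinv_mult[OF kh(1), of i] unfolding g by blast
qed (use assms continuous_on_kop in auto)

lemma iter_pd_kop:
  assumes "admissible k" "test h"
  shows "iter_pd is (kop k h) =
    kop (\<lambda>x. of_real (prod_list (map (\<lambda>i. vinv x $ i) is)) * k x) (iter_pd is h)"
proof (induction "is")
  case (Cons i "is")
  show ?case
    using dpart_eq[OF has_pd_kop[OF admissible_iter[OF assms(1)] test_iter_pd[OF assms(2)]], of i "is" "is"]
    by (simp add: Cons mult.assoc)
qed simp

text \<open>Where the integrand is nonzero no \<open>x $ i\<close> is 0, so \<open>z $ i\<close> is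
  the product of \<open>x $ i\<close> and the \<open>i\<close>-th coordinate of
  \<open>z * vinv x\<close>, both of them bounded. \<open>R0\<close> depends on \<open>k\<close>
  alone, which gives uniformity in \<open>h\<close>; the conclusion concerns the integrand so that
  it also serves for Fubini's theorem.\<close>

lemma kop_zero_outside:
  assumes "admissible (k :: 'n::finite fn)"
  obtains R0 where "0 \<le> R0" "\<And>h R1 z. 0 \<le> R1 \<Longrightarrow> (\<And>y. R1 < norm y \<Longrightarrow> h y = 0) \<Longrightarrow>
    R0 * R1 < norm z \<Longrightarrow> (\<lambda>x. k x * h (z * vinv x)) = (\<lambda>x. 0)"
proof -
  obtain R0 where R0: "0 \<le> R0" "\<And>x. R0 < norm x \<Longrightarrow> k x = 0"
    using assms unfolding admissible_def by blast
  have "k x * h (z * vinv x) = 0"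
    if R1: "0 \<le> R1" "\<And>y. R1 < norm y \<Longrightarrow> h y = 0" and z: "(CARD('n) * R0) * R1 < norm z"
    for h :: "'n fn" and R1 z x
  proof (rule ccontr)
    assume nz: "k x * h (z * vinv x) \<noteq> 0"
    then have x: "norm x \<le> R0" and zx: "norm (z * vinv x) \<le> R1"
      using R0(2)[of x] R1(2)[of "z * vinv x"] by (auto simp: not_less[symmetric])
    have "\<bar>z $ i\<bar> \<le> R0 * R1" for i
    proof -
      have "x $ i \<noteq> 0"
        using nz assms unfolding admissible_def by auto
      then have "\<bar>z $ i\<bar> = \<bar>x $ i\<bar> * \<bar>(z * vinv x) $ i\<bar>"
        by (simp add: abs_mult)
      also have "\<dots> \<le> R0 * R1"
        using order_trans[OF component_le_norm_cart x] order_trans[OF component_le_norm_cart zx] R0(1)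
        by (intro mult_mono) auto
      finally show ?thesis .
    qed
    \<comment> \<open>The factor \<open>CARD('n)\<close> in the radius comes from estimating the
      Euclidean norm by the sum of the absolute coordinates.\<close>
    then have "(\<Sum>i\<in>UNIV. \<bar>z $ i\<bar>) \<le> (CARD('n) * R0) * R1"
      using sum_bounded_above[of "UNIV :: 'n set" "\<lambda>i. \<bar>z $ i\<bar>" "R0 * R1"] by (simp add: mult.assoc)
    then show False
      using norm_le_l1_cart[of z] z by simp
  qed
  then show ?thesis
    using that[of "CARD('n) * R0"] R0(1) by (simp add: fun_eq_iff)
qed

lemma test_kop:
  assumes "admissible k" "test h"
  shows "test (kop k h)"
proof -
  obtain R1 where R1: "0 < R1" "\<And>y. R1 < norm y \<Longrightarrow> h y = 0"
    using test_supp_cball[OF assms(2)] by blast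
  obtain R0 where R0: "0 \<le> R0" "\<And>h R1 z. 0 \<le> R1 \<Longrightarrow> (\<And>y. R1 < norm y \<Longrightarrow> h y = 0) \<Longrightarrow>
      R0 * R1 < norm z \<Longrightarrow> (\<lambda>x. k x * h (z * vinv x)) = (\<lambda>x. 0)"
    using kop_zero_outside[OF assms(1)] by blast
  show ?thesis
  proof (rule testI[OF smooth_kop[OF assms], of "cball 0 (R0 * R1)"])
    show "kop k h z = 0" if "z \<notin> cball 0 (R0 * R1)" for z
      unfolding kop_def using R0(2)[of R1 h z] R1 that by simp
  qed simp
qed

text \<open>Up to sign the transpose of \<open>g \<mapsto> y^\<beta> \<partial>^\<beta> g\<close>;
  the reversed list is the order in which integration by parts moves the derivatives.\<close>

definition dop :: "'n::finite list \<Rightarrow> 'n fn \<Rightarrow> 'n fn" where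
  "dop bs \<phi> = iter_pd (rev bs) (mulc bs \<phi>)"

lemma test_dop: "test \<phi> \<Longrightarrow> test (dop bs \<phi>)"
  unfolding dop_def by (intro test_iter_pd test_mulc)

lemma dop_lincomb:
  assumes "test \<phi>" "test \<psi>"
  shows "dop bs (\<lambda>x. a * \<phi> x + b * \<psi> x) = (\<lambda>x. a * dop bs \<phi> x + b * dop bs \<psi> x)"
proof -
  have "mulc bs (\<lambda>x. a * \<phi> x + b * \<psi> x) = (\<lambda>x. a * mulc bs \<phi> x + b * mulc bs \<psi> x)"
    by (simp add: mulc_def fun_eq_iff algebra_simps)
  then show ?thesis
    using assms
    by (simp add: dop_def iter_pd_add iter_pd_cmult smooth_cmult smooth_mulc test_def)
qed

text \<open>With \<open>k \<beta> = kern (mlist \<beta>) (t \<beta>)\<close> below, this is the operator \<open>S\<close>.\<close>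

definition sop :: "('n::finite \<Rightarrow> nat) set \<Rightarrow> (('n \<Rightarrow> nat) \<Rightarrow> 'n fn) \<Rightarrow> 'n fn \<Rightarrow> 'n fn" where
  "sop B k \<phi> = (\<lambda>z. \<Sum>\<beta>\<in>B. kop (k \<beta>) (dop (mlist \<beta>) \<phi>) z)"

lemma sop_lincomb:
  assumes k: "\<And>\<beta>. \<beta> \<in> B \<Longrightarrow> admissible (k \<beta>)" and \<phi>: "test \<phi>" "test \<psi>"
  shows "sop B k (\<lambda>x. a * \<phi> x + b * \<psi> x) = (\<lambda>z. a * sop B k \<phi> z + b * sop B k \<psi> z)"
proof -
  have "kop (k \<beta>) (dop (mlist \<beta>) (\<lambda>x. a * \<phi> x + b * \<psi> x)) z =
      a * kop (k \<beta>) (dop (mlist \<beta>) \<phi>) z + b * kop (k \<beta>) (dop (mlist \<beta>) \<psi>) z" if "\<beta> \<in> B" for \<beta> z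
  proof -
    have "kop (k \<beta>) (dop (mlist \<beta>) (\<lambda>x. a * \<phi> x + b * \<psi> x)) z =
      (LINT x|lborel. a * (k \<beta> x * dop (mlist \<beta>) \<phi> (z * vinv x)) + b * (k \<beta> x * dop (mlist \<beta>) \<psi> (z * vinv x)))"
      unfolding kop_def dop_lincomb[OF \<phi>] by (simp add: algebra_simps)
    also have "\<dots> = a * kop (k \<beta>) (dop (mlist \<beta>) \<phi>) z + b * kop (k \<beta>) (dop (mlist \<beta>) \<psi>) z"
      unfolding kop_def
      using integrable_kop[OF k[OF that] test_dop[OF \<phi>(1)]] integrable_kop[OF k[OF that] test_dop[OF \<phi>(2)]]
      by simp
    finally show ?thesis .
  qed
  then show ?thesis
    by (simp add: sop_def sum.distrib sum_distrib_left)
qed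

text \<open>Multiplication by monomials and differentiation do not enlarge supports, so for all
  \<open>\<phi>\<close> supported in \<open>K\<close> the functions
  \<open>dop (mlist \<beta>) \<phi>\<close> vanish outside one common ball, and
  \<open>kop_zero_outside\<close> is uniform over such functions.\<close>

lemma sop_zero_outside:
  assumes B: "finite B" and k: "\<And>\<beta>. \<beta> \<in> B \<Longrightarrow> admissible (k \<beta> :: 'n::finite fn)" and K: "compact K"
  obtains R where "0 \<le> R" "\<And>\<phi> z. test \<phi> \<Longrightarrow> supp \<phi> \<subseteq> K \<Longrightarrow> R < norm z \<Longrightarrow> sop B k \<phi> z = 0"
proof -
  obtain R1 where R1: "0 < R1" "\<And>x. x \<in> K \<Longrightarrow> norm x \<le> R1"
    using compact_imp_bounded[OF K] unfolding bounded_pos by blast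
  have "\<exists>R0\<ge>0. \<forall>h z. (\<forall>y. R1 < norm y \<longrightarrow> h y = 0) \<longrightarrow>
      R0 * R1 < norm z \<longrightarrow> kop (k \<beta>) h z = 0" if \<beta>: "\<beta> \<in> B" for \<beta>
  proof -
    obtain R0 where R0: "0 \<le> R0" "\<And>h R1 z. 0 \<le> R1 \<Longrightarrow> (\<And>y. R1 < norm y \<Longrightarrow> h y = 0) \<Longrightarrow>
      R0 * R1 < norm z \<Longrightarrow> (\<lambda>x. k \<beta> x * h (z * vinv x)) = (\<lambda>x. 0)"
      using kop_zero_outside[OF k[OF \<beta>]] by blast
    have "kop (k \<beta>) h z = 0" if "\<And>y. R1 < norm y \<Longrightarrow> h y = 0" "R0 * R1 < norm z" for h z
      unfolding kop_def using R0(2)[of R1 h z] R1(1) that by simp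
    then show ?thesis
      using R0(1) by blast
  qed
  then obtain r where r: "\<And>\<beta>. \<beta> \<in> B \<Longrightarrow> 0 \<le> r \<beta>"
    "\<And>\<beta> h z. \<beta> \<in> B \<Longrightarrow> (\<And>y. R1 < norm y \<Longrightarrow> h y = 0) \<Longrightarrow>
      r \<beta> * R1 < norm z \<Longrightarrow> kop (k \<beta>) h z = 0"
    by metis
  \<comment> \<open>The sum of the radii bounds each of them and also makes sense for empty
    \<open>B\<close>.\<close>
  define R where "R = (\<Sum>\<beta>\<in>B. r \<beta> * R1)"
  have le: "r \<beta> * R1 \<le> R" if "\<beta> \<in> B" for \<beta>
    unfolding R_def using B r(1) R1(1) that
    by (intro member_le_sum[of \<beta> B "\<lambda>\<beta>. r \<beta> * R1"]) auto
  show ?thesis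
  proof (rule that[of R])
    show "0 \<le> R"
      unfolding R_def using r(1) R1(1) by (intro sum_nonneg) auto
    fix \<phi> :: "'n fn" and z :: "real^'n" assume \<phi>: "test \<phi>" "supp \<phi> \<subseteq> K" and z: "R < norm z"
    have "\<phi> y = 0" if "y \<notin> K" for y
      using that \<phi>(2) zero_outside_supp by blast
    then have "mulc (mlist \<beta>) \<phi> y = 0" if "y \<notin> K" for y \<beta>
      using that by (simp add: mulc_def)
    then have "dop (mlist \<beta>) \<phi> y = 0" if "y \<notin> K" for y \<beta>
      unfolding dop_def using K that by (intro iter_pd_zero_outside[of K]) (auto simp: compact_imp_closed)
    then have "dop (mlist \<beta>) \<phi> y = 0" if "R1 < norm y" for y \<beta>
      using R1(2)[of y] that by force
    then show "sop B k \<phi> z = 0"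
      unfolding sop_def using z le by (intro sum.neutral ballI r(2)) force+
  qed
qed

lemma test_sop:
  assumes "\<And>\<beta>. \<beta> \<in> B \<Longrightarrow> admissible (k \<beta>)" "finite B" "test \<phi>"
  shows "test (sop B k \<phi>)"
proof -
  have "smooth (sop B k \<phi>)"
    unfolding sop_def using assms by (intro smooth_sum smooth_kop test_dop)
  moreover have "compact (supp \<phi>)"
    using assms(3) by (simp add: test_def)
  then obtain R where "\<And>\<psi> z. test \<psi> \<Longrightarrow> supp \<psi> \<subseteq> supp \<phi> \<Longrightarrow> R < norm z \<Longrightarrow> sop B k \<psi> z = 0"
    using sop_zero_outside[of B k "supp \<phi>", OF assms(2,1)] by blast
  then have "sop B k \<phi> z = 0" if "z \<notin> cball 0 R" for z
    using assms(3) that by simp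
  ultimately show ?thesis
    by (rule testI[OF _ compact_cball])
qed

text \<open>The sup norm of \<open>kop k h\<close> is at most the \<open>L_1\<close> norm of
  \<open>k\<close> times the sup norm of \<open>h\<close>. Derivatives fall on \<open>h\<close> and
  change the kernel only by factors \<open>vinv x $ i\<close>; as \<open>h\<close> is supported in
  \<open>K\<close>, the bound holds at every \<open>z\<close> with a seminorm over
  \<open>K\<close>.\<close>

lemma dominated_kop:
  assumes k: "admissible k" and K: "compact K" "K \<noteq> {}"
  shows "dominated K {(\<phi>, x). test \<phi> \<and> supp \<phi> \<subseteq> K} (\<lambda>\<phi>. iter_pd is (kop k (dop bs \<phi>)))"
proof -
  from dominated_iter_pd_mulc[OF K, of "is @ rev bs" bs]
  obtain C N where C: "0 \<le> C" "\<And>\<phi> x. (\<phi>, x) \<in> {(\<phi>, x). smooth \<phi> \<and> x \<in> K} \<Longrightarrow>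
      norm (iter_pd (is @ rev bs) (mulc bs \<phi>) x) \<le> C * seminorm K N \<phi>"
    by (rule dominatedE) blast
  let ?k = "\<lambda>x. of_real (prod_list (map (\<lambda>i. vinv x $ i) is)) * k x"
  let ?I = "LINT x|lborel. norm (?k x)"
  show ?thesis
  proof (rule dominatedI[of "?I * C" _ _ _ N])
    fix \<phi> and z :: "real^'a" assume "(\<phi>, z) \<in> {(\<phi>, x). test \<phi> \<and> supp \<phi> \<subseteq> K}"
    then have \<phi>: "test \<phi>" "supp \<phi> \<subseteq> K"
      by auto
    have sm: "smooth \<phi>"
      using \<phi>(1) by (simp add: test_def)
    have z: "mulc bs \<phi> y = 0" if "y \<notin> K" for y
      using that \<phi>(2) zero_outside_supp[of y \<phi>] by (auto simp: mulc_def)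
    have bound: "norm (iter_pd is (dop bs \<phi>) y) \<le> C * seminorm K N \<phi>" for y
    proof (cases "y \<in> K")
      case True
      then show ?thesis
        using C(2)[of \<phi> y] sm by (simp add: dop_def iter_pd_append)
    next
      case False
      have "iter_pd (is @ rev bs) (mulc bs \<phi>) y = 0"
        using K(1) z False by (intro iter_pd_zero_outside[of K]) (auto simp: compact_imp_closed)
      then show ?thesis
        using C(1) seminorm_nonneg[OF sm K] by (simp add: dop_def iter_pd_append)
    qed
    show "norm (iter_pd is (kop k (dop bs \<phi>)) z) \<le> (?I * C) * seminorm K N \<phi>"
      unfolding iter_pd_kop[OF k test_dop[OF \<phi>(1)]]
      using norm_kop_le[OF admissible_iter[OF k] test_iter_pd[OF test_dop[OF \<phi>(1)]] bound]
      by (simp only: mult.assoc)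
  qed (use C(1) in simp)
qed

lemma distr_comp_sop:
  assumes B: "finite B" and k: "\<And>\<beta>. \<beta> \<in> B \<Longrightarrow> admissible (k \<beta> :: 'n::finite fn)" and u: "distr u"
  shows "distr (\<lambda>\<phi>. u (sop B k \<phi>))"
  unfolding distr_def
proof (intro conjI allI impI)
  have ts: "test (sop B k \<phi>)" if "test \<phi>" for \<phi>
    using k B that by (rule test_sop)
  have lin: "\<And>\<phi> \<psi> a b. test \<phi> \<Longrightarrow> test \<psi> \<Longrightarrow> u (\<lambda>x. a * \<phi> x + b * \<psi> x) = a * u \<phi> + b * u \<psi>"
    using u unfolding distr_def by blast
  show "u (sop B k (\<lambda>x. a * \<phi> x + b * \<psi> x)) = a * u (sop B k \<phi>) + b * u (sop B k \<psi>)"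
    if "test \<phi>" "test \<psi>" for \<phi> \<psi> a b
    using that by (simp add: sop_lincomb k lin ts)
  fix K :: "(real^'n) set" assume K: "compact K"
  show "\<exists>C N. \<forall>\<phi>. test \<phi> \<longrightarrow> supp \<phi> \<subseteq> K \<longrightarrow> norm (u (sop B k \<phi>)) \<le> C * seminorm K N \<phi>"
  proof (cases "K = {}")
    \<comment> \<open>For empty \<open>K\<close> the value of \<open>seminorm\<close> is
      unspecified, but \<open>\<phi>\<close> is 0 and linearity gives the bound with constant
      0.\<close>
    case True
    have "u (sop B k \<phi>) = 0" if "test \<phi>" "supp \<phi> \<subseteq> K" for \<phi>
    proof -
      have "\<phi> = (\<lambda>x. 0 * \<phi> x + 0 * \<phi> x)"
        using that True zero_outside_supp[of _ \<phi>] by auto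
      then have "sop B k \<phi> = (\<lambda>z. 0 * sop B k \<phi> z + 0 * sop B k \<phi> z)"
        using sop_lincomb[OF k that(1) that(1), where a = 0 and b = 0] by simp
      then show ?thesis
        using lin[OF ts[OF that(1)] ts[OF that(1)], where a = 0 and b = 0] by simp
    qed
    then show ?thesis
      by (intro exI[of _ 0]) simp
  next
    case False
    note K = K False
    let ?D = "{(\<phi>, x::real^'n). test \<phi> \<and> supp \<phi> \<subseteq> K}"
    have smD: "smooth \<phi>" if "(\<phi>, x) \<in> ?D" for \<phi> x
      using that by (auto simp: test_def)
    obtain R where R: "0 \<le> R" "\<And>\<phi> z. test \<phi> \<Longrightarrow> supp \<phi> \<subseteq> K \<Longrightarrow> R < norm z \<Longrightarrow> sop B k \<phi> z = 0"
      using sop_zero_outside[of B k K, OF B k K(1)] by blast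
    let ?K = "cball 0 R :: (real^'n) set"
    have K': "compact ?K" "?K \<noteq> {}"
      using R(1) by auto
    obtain C N where C: "\<And>\<phi>. test \<phi> \<Longrightarrow> supp \<phi> \<subseteq> ?K \<Longrightarrow> norm (u \<phi>) \<le> C * seminorm ?K N \<phi>"
      using u K'(1) unfolding distr_def by blast
    \<comment> \<open>The suprema in the seminorm of \<open>sop B k \<phi>\<close> are treated as
      complex quantities constant in \<open>x\<close>, so that the rules for
      \<open>dominated\<close> combine the finitely many constants and orders.\<close>
    have dom: "dominated K ?D (\<lambda>\<phi> x. complex_of_real (SUP z\<in>?K. norm (pdm \<alpha> (sop B k \<phi>) z)))" for \<alpha>
    proof -
      have "dominated K ?D (\<lambda>\<phi> z. \<Sum>\<beta>\<in>B. iter_pd (mlist \<alpha>) (kop (k \<beta>) (dop (mlist \<beta>) \<phi>)) z)"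
        by (intro dominated_sum[OF K smD] dominated_kop k K) auto
      then obtain C N where C: "0 \<le> C" "\<And>\<phi> z. (\<phi>, z) \<in> ?D \<Longrightarrow>
          norm (\<Sum>\<beta>\<in>B. iter_pd (mlist \<alpha>) (kop (k \<beta>) (dop (mlist \<beta>) \<phi>)) z) \<le> C * seminorm K N \<phi>"
        using dominatedE by blast
      show ?thesis
      proof (rule dominatedI[OF C(1)])
        fix \<phi> and x :: "real^'n" assume D: "(\<phi>, x) \<in> ?D"
        then have \<phi>: "test \<phi>"
          by simp
        have "pdm \<alpha> (sop B k \<phi>) z = (\<Sum>\<beta>\<in>B. iter_pd (mlist \<alpha>) (kop (k \<beta>) (dop (mlist \<beta>) \<phi>)) z)" for z
          unfolding pdm_def sop_def using k \<phi> by (simp add: iter_pd_sum smooth_kop test_dop)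
        then have "norm (pdm \<alpha> (sop B k \<phi>) z) \<le> C * seminorm K N \<phi>" for z
          using C(2)[of \<phi> z] D by simp
        then have "(SUP z\<in>?K. norm (pdm \<alpha> (sop B k \<phi>) z)) \<le> C * seminorm K N \<phi>"
          using K'(2) by (intro cSUP_least)
        moreover have "0 \<le> (SUP z\<in>?K. norm (pdm \<alpha> (sop B k \<phi>) z))"
          using ts[OF \<phi>] K' by (intro Sup_pdm_nonneg) (auto simp: test_def)
        ultimately show "norm (complex_of_real (SUP z\<in>?K. norm (pdm \<alpha> (sop B k \<phi>) z))) \<le> C * seminorm K N \<phi>"
          by simp
      qed
    qed
    have "dominated K ?D (\<lambda>\<phi> x. \<Sum>\<alpha>\<in>{\<alpha>. mabs \<alpha> \<le> N}. complex_of_real (SUP z\<in>?K. norm (pdm \<alpha> (sop B k \<phi>) z)))"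
      by (intro dominated_sum[OF K smD] dom) auto
    then have "dominated K ?D (\<lambda>\<phi> x. complex_of_real (seminorm ?K N (sop B k \<phi>)))"
      by (simp add: seminorm_def)
    then obtain C' N' where C': "0 \<le> C'" "\<And>\<phi> x. (\<phi>, x) \<in> ?D \<Longrightarrow>
        norm (complex_of_real (seminorm ?K N (sop B k \<phi>))) \<le> C' * seminorm K N' \<phi>"
      using dominatedE by blast
    \<comment> \<open>The constant \<open>C\<close> from the continuity of \<open>u\<close> may be
      negative, hence \<open>\<bar>C\<bar>\<close>. The point 0 at which \<open>C'(2)\<close> is
      used is a dummy.\<close>
    have "norm (u (sop B k \<phi>)) \<le> (\<bar>C\<bar> * C') * seminorm K N' \<phi>" if \<phi>: "test \<phi>" "supp \<phi> \<subseteq> K" for \<phi>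
    proof -
      have "supp (sop B k \<phi>) \<subseteq> ?K"
        using R(2)[OF \<phi>] by (subst supp_subset_iff) auto
      then have "norm (u (sop B k \<phi>)) \<le> C * seminorm ?K N (sop B k \<phi>)"
        by (intro C ts \<phi>)
      also have "\<dots> \<le> \<bar>C\<bar> * (C' * seminorm K N' \<phi>)"
        using C'(2)[of \<phi> 0] \<phi> ts[OF \<phi>(1)] K' seminorm_nonneg[of "sop B k \<phi>" ?K N]
        by (intro mult_mono) (auto simp: test_def)
      finally show ?thesis
        by (simp add: mult.assoc)
    qed
    then show ?thesis
      by blast
  qed
qed

subsection \<open>The transpose of \<open>M\<^sub>T\<close>\<close>

lemma prod_list_eq_prod_count:
  "prod_list (map a bs) = (\<Prod>i\<in>UNIV. a i ^ count_list bs i)" for a :: "'n::finite \<Rightarrow> real"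
proof (induction bs)
  case (Cons b bs)
  have "a i ^ count_list (b # bs) i = (if i = b then a i else 1) * a i ^ count_list bs i" for i
    by auto
  then have "(\<Prod>i\<in>UNIV. a i ^ count_list (b # bs) i) = a b * (\<Prod>i\<in>UNIV. a i ^ count_list bs i)"
    by (simp only: prod.distrib prod.delta[OF finite] UNIV_I if_True)
  then show ?case
    by (simp only: Cons list.map prod_list.Cons)
qed simp

text \<open>The function \<open>t(x) x^-\<beta>\<close> times the Jacobian of
  \<open>y = z/x\<close>. As \<open>vinv\<close> sends 0 to 0, the Jacobian factor makes the kernel
  vanish on the coordinate hyperplanes, even for \<open>bs = []\<close>.\<close>

definition kern :: "'n::finite list \<Rightarrow> 'n fn \<Rightarrow> 'n fn" where
  "kern bs t x = of_real \<bar>\<Prod>i\<in>UNIV. vinv x $ i\<bar> * (of_real (prod_list (map (\<lambda>i. vinv x $ i) bs)) * t x)"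

lemma admissible_kern:
  assumes t: "integrable lborel t"
    and K: "compact K" "\<And>x. x \<notin> K \<Longrightarrow> t x = 0"
    and int: "\<And>\<gamma>::'n::finite \<Rightarrow> nat. integrable lborel (\<lambda>x. t x / complex_of_real (\<Prod>i\<in>UNIV. (x $ i) ^ \<gamma> i))"
  shows "admissible (kern bs t)"
proof -
  have [measurable]: "t \<in> borel_measurable borel" "\<And>i. (\<lambda>x::real^'n. x $ i) \<in> borel_measurable borel"
    using borel_measurable_integrable[OF t] borel_measurable_vec_nth by auto
  have kern_eq: "kern bs t x = of_real \<bar>\<Prod>i\<in>UNIV. inverse (x $ i)\<bar> *
      (of_real (\<Prod>i\<in>UNIV. inverse (x $ i) ^ count_list bs i) * t x)" for x
    unfolding kern_def prod_list_eq_prod_count vinv_nth ..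
  have meas [measurable]: "kern bs t \<in> borel_measurable borel"
    unfolding kern_eq by measurable
  obtain R where R: "0 < R" "\<And>x. x \<in> K \<Longrightarrow> norm x \<le> R"
    using compact_imp_bounded[OF K(1)] unfolding bounded_pos by blast
  have "kern bs t x = 0" if "R < norm x" for x
    using R(2)[of x] K(2)[of x] that by (auto simp: kern_def)
  moreover have "kern bs t x = 0" if "x $ i = 0" for x i
  proof -
    have "(\<Prod>i\<in>UNIV. vinv x $ i) = 0"
      using that by (auto intro!: bexI[of _ i])
    then show ?thesis
      by (simp only: kern_def) simp
  qed
  moreover have "integrable lborel (\<lambda>x. kern bs t x * of_real (\<Prod>i\<in>UNIV. vinv x $ i ^ \<gamma> i))" for \<gamma>
  proof (rule Bochner_Integration.integrable_bound[OF int])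
    show "(\<lambda>x. kern bs t x * of_real (\<Prod>i\<in>UNIV. vinv x $ i ^ \<gamma> i)) \<in> borel_measurable lborel"
      unfolding vinv_nth by measurable
    \<comment> \<open>The exponent collects 1 from the Jacobian, \<open>count_list bs i\<close> from
      the monomial and \<open>\<gamma> i\<close> from admissibility. Being positive, it makes both
      sides 0 on the hyperplanes, so the equality holds for every \<open>x\<close>.\<close>
    have "norm (kern bs t x * of_real (\<Prod>i\<in>UNIV. vinv x $ i ^ \<gamma> i)) =
        norm (t x / of_real (\<Prod>i\<in>UNIV. (x $ i) ^ (Suc (count_list bs i + \<gamma> i))))" for x
      unfolding kern_eq vinv_nth
      by (simp add: norm_mult norm_divide power_add prod.distrib abs_mult abs_prod power_abs
          prod_inversef[symmetric] power_inverse divide_inverse mult_ac norm_inverse flip: prod_norm)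
    then show "AE x in lborel. norm (kern bs t x * of_real (\<Prod>i\<in>UNIV. vinv x $ i ^ \<gamma> i)) \<le>
        norm (t x / of_real (\<Prod>i\<in>UNIV. (x $ i) ^ (Suc (count_list bs i + \<gamma> i))))"
      by simp
  qed
  ultimately show ?thesis
    using R(1) meas unfolding admissible_def by (auto intro!: exI[of _ R])
qed

text \<open>The map \<open>z \<mapsto> z * vinv x\<close> is diagonal with nonzero entries, so
  Lebesgue measure is its own image under it with the absolute determinant as density.\<close>

lemma integral_lborel_scale:
  fixes g :: "'n::finite fn"
  assumes x: "\<And>i. x $ i \<noteq> 0" and [measurable]: "g \<in> borel_measurable borel"
  shows "(LINT y|lborel. g y) = of_real \<bar>\<Prod>i\<in>UNIV. vinv x $ i\<bar> * (LINT z|lborel. g (z * vinv x))"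
proof -
  define c where "c j = vinv x \<bullet> j" for j
  have T: "(\<Sum>j\<in>Basis. (c j * (z \<bullet> j)) *\<^sub>R j) = z * vinv x" for z
    by (rule euclidean_eqI)
       (auto simp: c_def inner_sum_left inner_Basis if_distrib sum.delta cong: if_cong
         simp: Basis_vec_def inner_axis)
  have prod: "(\<Prod>j\<in>Basis. \<bar>c j\<bar>) = \<bar>\<Prod>i\<in>UNIV. vinv x $ i\<bar>"
  proof -
    have "(Basis :: (real^'n) set) = range (\<lambda>i. axis i 1)"
      by (auto simp: Basis_vec_def)
    moreover have "inj (\<lambda>i::'n. axis i (1::real))"
      by (auto simp: inj_on_def axis_eq_axis)
    ultimately have "(\<Prod>j\<in>(Basis :: (real^'n) set). \<bar>c j\<bar>) = (\<Prod>i\<in>UNIV. \<bar>c (axis i 1)\<bar>)"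
      using prod.reindex[of "\<lambda>i. axis i 1" UNIV "\<lambda>j. \<bar>c j\<bar>"] by (simp add: o_def)
    then show ?thesis
      by (simp add: c_def inner_axis abs_prod)
  qed
  have m: "(\<lambda>z. z * vinv x) \<in> borel_measurable borel"
    by (intro borel_measurable_continuous_onI continuous_intros)
  have "c j \<noteq> 0" if "j \<in> Basis" for j
    using that x by (auto simp: Basis_vec_def c_def inner_axis)
  from lborel_affine_euclidean[of c 0, OF this]
  have "lborel = density (Measure_Space.distr lborel borel (\<lambda>z. z * vinv x)) (\<lambda>_. \<bar>\<Prod>i\<in>UNIV. vinv x $ i\<bar>)"
    unfolding T prod by simp
  then have "(LINT y|lborel. g y) =
      (LINT y|density (Measure_Space.distr lborel borel (\<lambda>z. z * vinv x)) (\<lambda>_. \<bar>\<Prod>i\<in>UNIV. vinv x $ i\<bar>). g y)"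
    by (rule arg_cong[where f = "\<lambda>M. integral\<^sup>L M g"])
  also have "\<dots> = (LINT y|Measure_Space.distr lborel borel (\<lambda>z. z * vinv x). \<bar>\<Prod>i\<in>UNIV. vinv x $ i\<bar> *\<^sub>R g y)"
    by (rule integral_density) auto
  also have "\<dots> = (LINT z|lborel. \<bar>\<Prod>i\<in>UNIV. vinv x $ i\<bar> *\<^sub>R g (z * vinv x))"
    using m by (subst integral_distr) auto
  also have "\<dots> = of_real \<bar>\<Prod>i\<in>UNIV. vinv x $ i\<bar> * (LINT z|lborel. g (z * vinv x))"
    unfolding scaleR_conv_of_real by (rule integral_mult_right_zero)
  finally show ?thesis .
qed

section \<open>Fubini's theorem and the identity for a single kernel\<close>

lemma integrable_pair_dominated:
  fixes F :: "real^'n::finite \<Rightarrow> real^'n \<Rightarrow> complex"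
  assumes F [measurable]: "case_prod F \<in> borel_measurable (lborel \<Otimes>\<^sub>M lborel)"
    and a: "integrable lborel a" and b: "integrable lborel b"
    and bound: "\<And>x y. norm (F x y) \<le> a x * b y"
  shows "integrable (lborel \<Otimes>\<^sub>M lborel) (case_prod F)"
proof (rule lborel_pair.Fubini_integrable[OF F])
  have Fx: "integrable lborel (F x)" for x
  proof (rule Bochner_Integration.integrable_bound)
    show "integrable lborel (\<lambda>y. a x * b y)"
      using b by simp
    show "F x \<in> borel_measurable lborel"
      using measurable_compose[OF measurable_Pair1' F, of x] by simp
    show "AE y in lborel. norm (F x y) \<le> norm (a x * b y)"
      using bound by (intro AE_I2) (metis abs_ge_self order_trans real_norm_def)
  qed
  then show "AE x in lborel. integrable lborel (\<lambda>y. case_prod F (x, y))"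
    by simp
  have "integrable lborel (\<lambda>x. LINT y|lborel. norm (F x y))"
  proof (rule Bochner_Integration.integrable_bound)
    show "integrable lborel (\<lambda>x. a x * (LINT y|lborel. b y))"
      using a by simp
    have "(\<lambda>x. LINT y|lborel. norm (case_prod F (x, y))) \<in> borel_measurable lborel"
      by measurable
    then show "(\<lambda>x. LINT y|lborel. norm (F x y)) \<in> borel_measurable lborel"
      by simp
    show "AE x in lborel. norm (LINT y|lborel. norm (F x y)) \<le> norm (a x * (LINT y|lborel. b y))"
    proof (rule AE_I2)
      fix x
      have "(LINT y|lborel. norm (F x y)) \<le> (LINT y|lborel. a x * b y)"
        using b bound Fx by (intro integral_mono) auto
      then show "norm (LINT y|lborel. norm (F x y)) \<le> norm (a x * (LINT y|lborel. b y))"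
        by simp
    qed
  qed
  then show "integrable lborel (\<lambda>x. LINT y|lborel. norm (case_prod F (x, y)))"
    by simp
qed

lemma AE_lborel_nth_nonzero: "AE x in lborel. \<forall>i. (x::real^'n::finite) $ i \<noteq> 0"
proof -
  have "AE x in lborel. (x::real^'n) $ i \<noteq> 0" for i
  proof -
    have "axis i 1 \<in> (Basis :: (real^'n) set)"
      by (auto simp: Basis_vec_def)
    from AE_lborel_inner_neq[OF this, of 0] show ?thesis
      by (simp add: inner_axis)
  qed
  then show ?thesis
    by (simp add: AE_all_countable)
qed

text \<open>For \<open>x\<close> off the hyperplanes the chain rule writes
  \<open>(\<partial>^\<beta> f)(xy)\<close> as \<open>x^-\<beta>\<close> times a derivative of
  \<open>f(xy)\<close> in \<open>y\<close>. This derivative can be moved onto the test function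
  before \<open>z = xy\<close> is substituted, and the negative power joins the Jacobian in
  \<open>kern\<close>.\<close>

lemma integral_scaled_derivative:
  assumes x: "\<And>i. (x::real^'n::finite) $ i \<noteq> 0" and \<phi>: "test \<phi>" and f: "smooth f"
  shows "t x * (LINT y|lborel. mulc bs \<phi> y * iter_pd bs f (x * y)) =
    (-1) ^ length bs * (kern bs t x * (LINT z|lborel. dop bs \<phi> (z * vinv x) * f z))"
proof -
  let ?p = "complex_of_real (prod_list (map (\<lambda>i. vinv x $ i) bs))"
  have p: "?p * of_real (prod_list (map (\<lambda>i. x $ i) bs)) = 1"
    by (induction bs) (use x in \<open>auto simp: field_simps\<close>)
  have "iter_pd bs f (x * y) = ?p * iter_pd bs (\<lambda>y. f (y * x)) y" for y
    unfolding iter_pd_scale[OF f] mult.assoc[symmetric] p by (simp add: mult.commute)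
  then have "(LINT y|lborel. mulc bs \<phi> y * iter_pd bs f (x * y)) =
      (LINT y|lborel. ?p * (mulc bs \<phi> y * iter_pd bs (\<lambda>y. f (y * x)) y))"
    by (simp only: mult.left_commute)
  also have "\<dots> = ?p * (LINT y|lborel. mulc bs \<phi> y * iter_pd bs (\<lambda>y. f (y * x)) y)"
    by (rule integral_mult_right_zero)
  also have "\<dots> = ?p * ((-1) ^ length bs * (LINT y|lborel. dop bs \<phi> y * f (y * x)))"
    unfolding dop_def by (subst integral_by_parts_iter[OF test_mulc[OF \<phi>] smooth_scale[OF f]]) (rule refl)
  also have "(LINT y|lborel. dop bs \<phi> y * f (y * x)) = of_real \<bar>\<Prod>i\<in>UNIV. vinv x $ i\<bar> *
      (LINT z|lborel. dop bs \<phi> (z * vinv x) * f z)"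
  proof -
    have "smooth (\<lambda>y. dop bs \<phi> y * f (y * x))"
      using test_dop[OF \<phi>, of bs] by (intro smooth_mult smooth_scale f) (simp add: test_def)
    then have "(\<lambda>y. dop bs \<phi> y * f (y * x)) \<in> borel_measurable borel"
      by (intro borel_measurable_continuous_onI smooth_continuous)
    moreover have "z * vinv x * x = z" for z
      using x by (simp add: vec_eq_iff)
    ultimately show ?thesis
      using integral_lborel_scale[OF x, of "\<lambda>y. dop bs \<phi> y * f (y * x)"] by simp
  qed
  finally show ?thesis
    by (simp only: kern_def mult_ac)
qed

lemma borel_measurable_lborel_pair:
  fixes F :: "(real^'n::finite) \<times> (real^'n) \<Rightarrow> complex"
  shows "F \<in> borel_measurable (lborel \<Otimes>\<^sub>M lborel) \<longleftrightarrow> F \<in> borel_measurable borel"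
  by (simp add: lborel_prod)

text \<open>The contribution of a single \<open>t_\<beta>\<close>. The \<open>y\<close> integral is
  brought inside, rewritten as a \<open>z\<close> integral for almost every \<open>x\<close>, and
  brought outside again. As the substitution depends on \<open>x\<close>, each of the two exchanges
  has its own majorant.\<close>

lemma kernel_identity:
  fixes t \<phi> f :: "'n::finite fn"
  assumes t: "integrable lborel t" and K: "compact K" "\<And>x. x \<notin> K \<Longrightarrow> t x = 0"
    and k: "admissible (kern bs t)" and \<phi>: "test \<phi>" and f: "smooth f"
  defines "I \<equiv> \<lambda>y. (LINT x|lborel. t x * iter_pd bs (\<lambda>x. f (x * y)) x) * \<phi> y"
  shows "integrable lborel I"
    and "(LINT y|lborel. I y) = (-1) ^ length bs * (LINT z|lborel. f z * kop (kern bs t) (dop bs \<phi>) z)"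
proof -
  let ?k = "kern bs t" and ?h = "dop bs \<phi>" and ?G = "mulc bs \<phi>" and ?D = "iter_pd bs f"
  have tG: "test ?G" and th: "test ?h"
    using \<phi> by (simp_all add: test_mulc test_dop)
  have smD: "smooth ?D"
    using f by (rule smooth_iter_pd)
  define F where "F x y = t x * (?G y * ?D (x * y))" for x y
  have I: "I y = (LINT x|lborel. F x y)" for y
  proof -
    have "F x y = (t x * iter_pd bs (\<lambda>x. f (x * y)) x) * \<phi> y" for x
      unfolding F_def iter_pd_scale[OF f] mulc_def by (simp only: mult_ac)
    then show ?thesis
      unfolding I_def by (simp only: integral_mult_left_zero)
  qed
  obtain R1 where R1: "\<And>y. R1 < norm y \<Longrightarrow> ?G y = 0"
    using test_supp_cball[OF tG] by blast
  have "bounded ((\<lambda>p. ?D (fst p * snd p)) ` (K \<times> cball 0 R1))"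
    using K(1)
    by (intro compact_imp_bounded compact_continuous_image compact_Times
        continuous_on_compose2[OF smooth_continuous[OF smD]] continuous_intros) auto
  then obtain M where M: "0 < M" "\<And>x y. x \<in> K \<Longrightarrow> norm y \<le> R1 \<Longrightarrow> norm (?D (x * y)) \<le> M"
    unfolding bounded_pos by force
  \<comment> \<open>Since \<open>t\<close> vanishes off \<open>K\<close> and \<open>?G\<close>
    beyond \<open>R1\<close>, only a compact set of pairs matters, and \<open>?D (x * y)\<close> is
    bounded on it.\<close>
  have intF: "integrable (lborel \<Otimes>\<^sub>M lborel) (case_prod F)"
  proof (rule integrable_pair_dominated[where a = "\<lambda>x. norm (t x)" and b = "\<lambda>y. M * norm (?G y)"])
    have "continuous_on UNIV (\<lambda>p::(real^'n) \<times> (real^'n). ?G (snd p) * ?D (fst p * snd p))"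
      by (intro continuous_intros continuous_on_compose2[OF smooth_continuous[OF smD]]
          continuous_on_compose2[OF smooth_continuous[of ?G]]) (use tG in \<open>auto simp: test_def\<close>)
    then have "(\<lambda>p. ?G (snd p) * ?D (fst p * snd p)) \<in> borel_measurable (lborel \<Otimes>\<^sub>M lborel)"
      unfolding borel_measurable_lborel_pair by (rule borel_measurable_continuous_onI)
    moreover have "(\<lambda>p. t (fst p)) \<in> borel_measurable (lborel \<Otimes>\<^sub>M lborel)"
      by (rule measurable_compose[OF measurable_fst borel_measurable_integrable[OF t]])
    ultimately show "case_prod F \<in> borel_measurable (lborel \<Otimes>\<^sub>M lborel)"
      unfolding F_def split_beta' by (rule borel_measurable_times[rotated])
    show "norm (F x y) \<le> norm (t x) * (M * norm (?G y))" for x y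
    proof (cases "x \<in> K \<and> norm y \<le> R1")
      case True
      then have "norm (?G y) * norm (?D (x * y)) \<le> norm (?G y) * M"
        by (intro mult_left_mono M(2)) auto
      then show ?thesis
        unfolding F_def norm_mult by (intro mult_left_mono) (auto simp: mult.commute)
    next
      case False
      then have "F x y = 0"
        using K(2)[of x] R1[of y] by (auto simp: F_def)
      then show ?thesis
        using M(1) by simp
    qed
  qed (use t integrable_test[OF tG] in auto)
  show "integrable lborel I"
    unfolding I using lborel_pair.integrable_snd[OF intF] .
  obtain Mh where Mh: "0 \<le> Mh" "\<And>y. norm (?h y) \<le> Mh"
    using test_bounded[OF th] by blast
  obtain R2 where R2: "0 < R2" "\<And>y. R2 < norm y \<Longrightarrow> ?h y = 0"
    using test_supp_cball[OF th] by blast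
  obtain R0 where "0 \<le> R0" and R0: "\<And>h R1 z. 0 \<le> R1 \<Longrightarrow> (\<And>y. R1 < norm y \<Longrightarrow> h y = 0) \<Longrightarrow>
      R0 * R1 < norm z \<Longrightarrow> (\<lambda>x. ?k x * h (z * vinv x)) = (\<lambda>x. 0)"
    using kop_zero_outside[OF k] by blast
  let ?R = "R0 * R2"
  have "bounded (f ` cball 0 ?R)"
    using f by (intro compact_imp_bounded compact_continuous_image
        continuous_on_subset[OF smooth_continuous]) auto
  then obtain Mf where Mf: "0 < Mf" "\<And>z. norm z \<le> ?R \<Longrightarrow> norm (f z) \<le> Mf"
    unfolding bounded_pos by force
  define E where "E x z = ?k x * (?h (z * vinv x) * f z)" for x z
  \<comment> \<open>For \<open>norm z > ?R\<close> the integrand vanishes whatever \<open>x\<close>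
    is; this yields a majorant in \<open>z\<close> that is uniform in \<open>x\<close>.\<close>
  have intE: "integrable (lborel \<Otimes>\<^sub>M lborel) (case_prod E)"
  proof (rule integrable_pair_dominated[where a = "\<lambda>x. norm (?k x)"
        and b = "\<lambda>z. (Mh * Mf) * indicator (cball 0 ?R) z"])
    have "continuous_on UNIV (\<lambda>p::(real^'n) \<times> (real^'n). ?h (snd p * fst p) * f (snd p))"
      by (intro continuous_intros continuous_on_compose2[OF smooth_continuous[OF f]]
          continuous_on_compose2[OF smooth_continuous[of ?h]]) (use th in \<open>auto simp: test_def\<close>)
    moreover have "(\<lambda>p::(real^'n) \<times> (real^'n). (vinv (fst p), snd p)) \<in> borel_measurable (lborel \<Otimes>\<^sub>M lborel)"
      by (intro borel_measurable_Pair measurable_compose[OF measurable_fst] measurable_compose[OF measurable_snd])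
         (use borel_measurable_vinv in auto)
    ultimately have "(\<lambda>p. ?h (snd (vinv (fst p), snd p) * fst (vinv (fst p), snd p)) * f (snd (vinv (fst p), snd p)))
        \<in> borel_measurable (lborel \<Otimes>\<^sub>M (lborel :: (real^'n) measure))"
      by (rule borel_measurable_continuous_on)
    then have "(\<lambda>p. ?h (snd p * vinv (fst p)) * f (snd p)) \<in> borel_measurable (lborel \<Otimes>\<^sub>M lborel)"
      by simp
    moreover have "(\<lambda>p. ?k (fst p)) \<in> borel_measurable (lborel \<Otimes>\<^sub>M lborel)"
      using admissible_measurable[OF k] by (intro measurable_compose[OF measurable_fst]) auto
    ultimately show "case_prod E \<in> borel_measurable (lborel \<Otimes>\<^sub>M lborel)"
      unfolding E_def split_beta' by (rule borel_measurable_times[rotated])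
    show "norm (E x z) \<le> norm (?k x) * ((Mh * Mf) * indicator (cball 0 ?R) z)" for x z
    proof (cases "norm z \<le> ?R")
      case True
      then have "norm (?h (z * vinv x)) * norm (f z) \<le> Mh * Mf"
        using Mh Mf by (intro mult_mono) auto
      then show ?thesis
        using True unfolding E_def norm_mult by (simp add: mult_left_mono)
    next
      case False
      then have "?k x * ?h (z * vinv x) = 0"
        using R0[of R2 ?h z] R2 by (auto simp: fun_eq_iff)
      then have "E x z = 0"
        by (auto simp: E_def)
      then show ?thesis
        using Mh(1) Mf(1) by simp
    qed
    show "integrable lborel (\<lambda>z::real^'n. (Mh * Mf) * indicator (cball 0 ?R) z)"
      by (rule integrable_indicator_cball)
  qed (use admissible_integrable[OF k] in auto)
  have Ez: "(LINT x|lborel. E x z) = f z * kop ?k ?h z" for z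
  proof -
    have "(LINT x|lborel. E x z) = (LINT x|lborel. f z * (?k x * ?h (z * vinv x)))"
      unfolding E_def by (simp only: mult_ac)
    then show ?thesis
      unfolding kop_def by (simp only: integral_mult_right_zero)
  qed
  have "(LINT y|lborel. I y) = (LINT x|lborel. LINT y|lborel. F x y)"
    unfolding I by (rule lborel_pair.Fubini_integral[OF intF])
  also have "\<dots> = (LINT x|lborel. (-1) ^ length bs * (LINT z|lborel. E x z))"
  \<comment> \<open>The inner integrals are compared off the coordinate hyperplanes, which form a
    null set.\<close>
  proof (rule integral_cong_AE)
    show "AE x in lborel. (LINT y|lborel. F x y) = (-1) ^ length bs * (LINT z|lborel. E x z)"
      using AE_lborel_nth_nonzero
    proof eventually_elim
      case (elim x)
      then show ?case
        unfolding F_def E_def integral_mult_right_zero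
        by (intro integral_scaled_derivative \<phi> f) auto
    qed
    show "(\<lambda>x. LINT y|lborel. F x y) \<in> borel_measurable lborel"
      using lborel_pair.integrable_fst[OF intF] by (rule borel_measurable_integrable)
    show "(\<lambda>x. (-1) ^ length bs * (LINT z|lborel. E x z)) \<in> borel_measurable lborel"
      using borel_measurable_integrable[OF lborel_pair.integrable_fst[OF intE]] by simp
  qed
  also have "\<dots> = (-1) ^ length bs * (LINT z|lborel. LINT x|lborel. E x z)"
    unfolding lborel_pair.Fubini_integral[OF intE] by (rule integral_mult_right_zero)
  also have "\<dots> = (-1) ^ length bs * (LINT z|lborel. f z * kop ?k ?h z)"
    unfolding Ez ..
  finally show "(LINT y|lborel. I y) = (-1) ^ length bs * (LINT z|lborel. f z * kop ?k ?h z)" .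
qed

text \<open>The bound in \<^const>\<open>Eprime\<close> does not see a function vanishing near its compact set; scaling
  covers the case of an empty compact set, where \<^const>\<open>seminorm\<close> is a junk constant.\<close>

lemma Eprime_local:
  assumes T: "Eprime T"
  obtains K where "compact K" "\<And>U g. open U \<Longrightarrow> K \<subseteq> U \<Longrightarrow> smooth g \<Longrightarrow> (\<And>x. x \<in> U \<Longrightarrow> g x = 0) \<Longrightarrow> T g = 0"
proof -
  obtain K C N where K: "compact K" and bound: "\<And>f. smooth f \<Longrightarrow> norm (T f) \<le> C * seminorm K N f"
    using T unfolding Eprime_def by blast
  have "T g = 0" if U: "open U" "K \<subseteq> U" and g: "smooth g" "\<And>x. x \<in> U \<Longrightarrow> g x = 0" for U g
  proof (rule ccontr)
    assume nz: "T g \<noteq> 0"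
    let ?c = "C * seminorm K N (\<lambda>x. 0)"
    have le: "norm a * norm (T g) \<le> ?c" for a :: complex
    proof -
      have "pdm \<alpha> (\<lambda>x. a * g x) x = pdm \<alpha> (\<lambda>x. 0) x" if "x \<in> K" for \<alpha> x
        unfolding pdm_def using U g(2) that by (intro iter_pd_cong_open[of U]) auto
      then have "seminorm K N (\<lambda>x. a * g x) = seminorm K N (\<lambda>x. 0)"
        unfolding seminorm_def by (simp cong: SUP_cong)
      moreover have "T (\<lambda>x. a * g x + 0 * g x) = a * T g + 0 * T g"
        using T g(1) unfolding Eprime_def by blast
      ultimately show ?thesis
        using bound[OF smooth_cmult[OF g(1), of a]] by (simp add: norm_mult)
    qed
    obtain n :: nat where "?c < real n * norm (T g)"
      using ex_less_of_nat_mult[of "norm (T g)" ?c] nz by auto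
    then show False
      using le[of "of_nat n"] by simp
  qed
  then show ?thesis
    using that[OF K] by blast
qed

text \<open>The function \<open>f\<close> minus its cutoff vanishes on an open neighbourhood of the
  compact set controlling \<open>T\<close>, so both have the same value under \<open>T\<close>. The
  neighbourhood also contains the sets carrying the \<open>t_\<beta>\<close>, so the cutoff
  disappears from the integrals.\<close>

lemma Eprime_repr_smooth:
  assumes T: "Eprime T" and B: "finite B"
    and supp: "\<And>\<beta>. \<beta> \<in> B \<Longrightarrow> \<exists>K. compact K \<and> (\<forall>x. x \<notin> K \<longrightarrow> t \<beta> x = 0)"
    and repr: "\<And>\<phi>. test \<phi> \<Longrightarrow>
      T \<phi> = (\<Sum>\<beta>\<in>B. (-1) ^ mabs \<beta> * (LINT x|lborel. t \<beta> x * pdm \<beta> \<phi> x))"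
    and f: "smooth f"
  shows "T f = (\<Sum>\<beta>\<in>B. (-1) ^ mabs \<beta> * (LINT x|lborel. t \<beta> x * iter_pd (mlist \<beta>) f x))"
proof -
  obtain K where K: "compact K" "\<And>U g. open U \<Longrightarrow> K \<subseteq> U \<Longrightarrow> smooth g \<Longrightarrow> (\<And>x. x \<in> U \<Longrightarrow> g x = 0) \<Longrightarrow> T g = 0"
    using Eprime_local[OF T] by blast
  obtain k where k: "\<And>\<beta>. \<beta> \<in> B \<Longrightarrow> compact (k \<beta>)" "\<And>\<beta> x. \<beta> \<in> B \<Longrightarrow> x \<notin> k \<beta> \<Longrightarrow> t \<beta> x = 0"
    using supp by metis
  have "compact (K \<union> (\<Union>\<beta>\<in>B. k \<beta>))"
    using K(1) k(1) B by (intro compact_Un compact_UN) auto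
  then obtain \<eta> U where \<eta>: "test \<eta>" "open U" "K \<union> (\<Union>\<beta>\<in>B. k \<beta>) \<subseteq> U" "\<And>x. x \<in> U \<Longrightarrow> \<eta> x = 1"
    using cutoff_exists by blast
  let ?g = "\<lambda>x. f x * \<eta> x"
  have tg: "test ?g"
    using test_mult[OF f \<eta>(1)] .
  have sg: "smooth ?g"
    using tg by (simp add: test_def)
  \<comment> \<open>The coefficients are written out to match the form of linearity in
    \<open>Eprime\<close>.\<close>
  let ?d = "\<lambda>x. 1 * f x + (-1) * ?g x"
  have "smooth ?d"
    by (intro smooth_add smooth_cmult f sg)
  then have "T ?d = 0"
    using \<eta>(3,4) by (intro K(2)[OF \<eta>(2)]) auto
  moreover have "T ?d = 1 * T f + (-1) * T ?g"
    using T f sg unfolding Eprime_def by blast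
  ultimately have "T f = T ?g"
    by simp
  also have "\<dots> = (\<Sum>\<beta>\<in>B. (-1) ^ mabs \<beta> * (LINT x|lborel. t \<beta> x * pdm \<beta> ?g x))"
    by (rule repr[OF tg])
  also have "\<dots> = (\<Sum>\<beta>\<in>B. (-1) ^ mabs \<beta> * (LINT x|lborel. t \<beta> x * iter_pd (mlist \<beta>) f x))"
  proof -
    have "t \<beta> x * pdm \<beta> ?g x = t \<beta> x * iter_pd (mlist \<beta>) f x" if \<beta>: "\<beta> \<in> B" for \<beta> x
    proof (cases "x \<in> k \<beta>")
      case True
      then have "x \<in> U"
        using \<beta> \<eta>(3) by blast
      then have "pdm \<beta> ?g x = iter_pd (mlist \<beta>) f x"
        unfolding pdm_def using \<eta>(2,4) by (intro iter_pd_cong_open[of U]) auto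
      then show ?thesis
        by simp
    qed (use k(2)[OF \<beta>] in simp)
    then show ?thesis
      by (simp only: cong: sum.cong)
  qed
  finally show ?thesis .
qed

text \<open>The image of \<open>u\<close> reads \<open>u\<close> at the single test function
  \<open>sop B k \<phi>\<close>, so this function together with \<open>\<delta> = \<epsilon>\<close>
  witnesses weak-* continuity; linearity is that of composition.\<close>

lemma cont_lin_op_comp_sop:
  assumes B: "finite B" and k: "\<And>\<beta>. \<beta> \<in> B \<Longrightarrow> admissible (k \<beta>)"
  shows "cont_lin_op (\<lambda>u \<phi>. u (sop B k \<phi>))"
proof -
  have ts: "test (sop B k \<phi>)" if "test \<phi>" for \<phi>
    using k B that by (rule test_sop)
  show ?thesis
    unfolding cont_lin_op_def
  proof (intro conjI allI impI)
    show "distr (\<lambda>\<phi>. u (sop B k \<phi>))" if "distr u" for u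
      using B k that by (rule distr_comp_sop)
    show "deq (\<lambda>\<phi>. u (sop B k \<phi>)) (\<lambda>\<phi>. v (sop B k \<phi>))" if "deq u v" for u v
      using that ts by (simp add: deq_def)
    show "\<exists>\<Psi> \<delta>. finite \<Psi> \<and> (\<forall>\<psi>\<in>\<Psi>. test \<psi>) \<and> \<delta> > 0 \<and>
        (\<forall>u. distr u \<longrightarrow> (\<forall>\<psi>\<in>\<Psi>. norm (u \<psi>) < \<delta>) \<longrightarrow> norm (u (sop B k \<phi>)) < \<epsilon>)"
      if "test \<phi>" "\<epsilon> > 0" for \<phi> \<epsilon>
      using ts[OF that(1)] that(2) by (intro exI[of _ "{sop B k \<phi>}"] exI[of _ \<epsilon>]) simp
  qed (simp add: deq_def)
qed

text \<open>Monomials are multiplicative for the coordinatewise product, so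
  \<open>monomial \<alpha> y\<close> comes out of \<open>T\<close> by linearity.\<close>

lemma MT_monomial:
  assumes "Eprime T"
  shows "MT T (monomial \<alpha>) = (\<lambda>y. T (monomial \<alpha>) * monomial \<alpha> y)"
proof
  fix y
  have "(\<lambda>x. monomial \<alpha> (x * y)) = (\<lambda>x. monomial \<alpha> y * monomial \<alpha> x + 0 * monomial \<alpha> x)"
    by (simp add: monomial_def fun_eq_iff power_mult_distrib prod.distrib mult.commute)
  moreover have "T (\<lambda>x. monomial \<alpha> y * monomial \<alpha> x + 0 * monomial \<alpha> x) =
      monomial \<alpha> y * T (monomial \<alpha>) + 0 * T (monomial \<alpha>)"
    using assms smooth_monomial unfolding Eprime_def by blast
  ultimately show "MT T (monomial \<alpha>) y = T (monomial \<alpha>) * monomial \<alpha> y"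
    by (simp add: MT_def mult.commute)
qed

theorem theorem9:
  fixes T :: "'n::finite functional"
    and B :: "('n \<Rightarrow> nat) set"
    and t :: "('n \<Rightarrow> nat) \<Rightarrow> 'n fn"
  assumes "Eprime T"
    and "finite B"
    and "\<forall>\<beta>\<in>B. integrable lborel (t \<beta>)"
    and "\<forall>\<beta>\<in>B. \<exists>K. compact K \<and> (\<forall>x. x \<notin> K \<longrightarrow> t \<beta> x = 0)"
    and "\<forall>\<beta>\<in>B. \<forall>\<gamma>::'n \<Rightarrow> nat.
           integrable lborel (\<lambda>x. t \<beta> x / complex_of_real (\<Prod>i\<in>UNIV. (x $ i) ^ \<gamma> i))"
    and "\<forall>\<phi>. test \<phi> \<longrightarrow>
           T \<phi> = (\<Sum>\<beta>\<in>B. (-1) ^ mabs \<beta> * (LINT x|lborel. t \<beta> x * pdm \<beta> \<phi> x))"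
  shows "\<exists>L. Mclass L \<and> (\<forall>f. smooth f \<longrightarrow> deq (L (emb f)) (emb (MT T f)))"
proof -
  obtain K where K: "\<And>\<beta>. \<beta> \<in> B \<Longrightarrow> compact (K \<beta>)" "\<And>\<beta> x. \<beta> \<in> B \<Longrightarrow> x \<notin> K \<beta> \<Longrightarrow> t \<beta> x = 0"
    using assms(4) by metis
  define k where "k \<beta> = kern (mlist \<beta>) (t \<beta>)" for \<beta>
  have k: "admissible (k \<beta>)" if "\<beta> \<in> B" for \<beta>
    unfolding k_def using assms(3,5) that by (intro admissible_kern[OF _ K[OF that]]) auto
  define L :: "'n functional \<Rightarrow> 'n functional" where "L u \<phi> = u (sop B k \<phi>)" for u \<phi>
  have extends: "deq (L (emb f)) (emb (MT T f))" if f: "smooth f" for f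
    unfolding deq_def
  proof (intro allI impI)
    fix \<phi> :: "'n fn" assume \<phi>: "test \<phi>"
    define I where "I \<beta> y = (LINT x|lborel. t \<beta> x * iter_pd (mlist \<beta>) (\<lambda>x. f (x * y)) x) * \<phi> y" for \<beta> y
    have I: "integrable lborel (I \<beta>)"
      "(LINT y|lborel. I \<beta> y) = (-1) ^ mabs \<beta> * (LINT z|lborel. f z * kop (k \<beta>) (dop (mlist \<beta>) \<phi>) z)"
      if "\<beta> \<in> B" for \<beta>
      using kernel_identity[of "t \<beta>" "K \<beta>" "mlist \<beta>" \<phi> f] assms(3) K[OF that] k[OF that] \<phi> f that
      unfolding I_def k_def length_mlist by auto
    have "MT T f y * \<phi> y = (\<Sum>\<beta>\<in>B. (-1) ^ mabs \<beta> * I \<beta> y)" for y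
    proof -
      have "T (\<lambda>x. f (x * y)) = (\<Sum>\<beta>\<in>B. (-1) ^ mabs \<beta> *
          (LINT x|lborel. t \<beta> x * iter_pd (mlist \<beta>) (\<lambda>x. f (x * y)) x))"
        using assms(4,6) by (intro Eprime_repr_smooth[OF assms(1,2)] smooth_scale f) auto
      then show ?thesis
        by (simp add: MT_def I_def sum_distrib_right mult.assoc)
    qed
    then have "emb (MT T f) \<phi> = (\<Sum>\<beta>\<in>B. (-1) ^ mabs \<beta> * (LINT y|lborel. I \<beta> y))"
      using I(1) by (simp add: emb_def)
    also have "\<dots> = (\<Sum>\<beta>\<in>B. LINT z|lborel. f z * kop (k \<beta>) (dop (mlist \<beta>) \<phi>) z)"
    proof (intro sum.cong refl)
      fix \<beta> assume "\<beta> \<in> B"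
      \<comment> \<open>One sign belongs to the distributional derivative of
        \<open>t_\<beta>\<close>, the other to the integration by parts in \<open>y\<close>.\<close>
      have "(-1) ^ mabs \<beta> * (-1) ^ mabs \<beta> = (1::complex)"
        by (simp flip: power_mult_distrib)
      then show "(-1) ^ mabs \<beta> * (LINT y|lborel. I \<beta> y) =
          (LINT z|lborel. f z * kop (k \<beta>) (dop (mlist \<beta>) \<phi>) z)"
        unfolding I(2)[OF \<open>\<beta> \<in> B\<close>] mult.assoc[symmetric] by simp
    qed
    also have "\<dots> = (LINT z|lborel. (\<Sum>\<beta>\<in>B. f z * kop (k \<beta>) (dop (mlist \<beta>) \<phi>) z))"
      using k \<phi> f
      by (intro Bochner_Integration.integral_sum[symmetric] integrable_test test_mult test_kop test_dop)
    also have "\<dots> = L (emb f) \<phi>"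
      by (simp add: L_def emb_def sop_def sum_distrib_left)
    finally show "L (emb f) \<phi> = emb (MT T f) \<phi>" ..
  qed
  have "cont_lin_op L"
    using cont_lin_op_comp_sop[OF assms(2) k] by (simp add: L_def[abs_def])
  \<comment> \<open>Monomials are smooth, so the extension property carries the eigenvalues of
    \<open>M_T\<close> over to \<open>L\<close>.\<close>
  moreover have "deq (L (emb (monomial \<alpha>))) (\<lambda>\<phi>. T (monomial \<alpha>) * emb (monomial \<alpha>) \<phi>)" for \<alpha>
    using extends[OF smooth_monomial, of \<alpha>]
    by (simp add: MT_monomial[OF assms(1)] emb_def mult.assoc)
  ultimately have "Mclass L"
    unfolding Mclass_def by blast
  then show ?thesis
    using extends by blast
qed

end
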